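(* There are absolute constants $c,c',C>0$ such that the following holds. Let $p$ be a prime and let $A\subseteq\mathbb{F}_p$ be a nonempty set with $|A|\le e^{c\sqrt{\log p}}$. Then there exists $x\in\mathbb{F}_p$ such that $$0<(A*A)(x)\le C\,e^{-c'(\log|A|)^{1/4}}\,|A|.$$
   Context: $\mathbb{F}_p=\mathbb{Z}/p\mathbb{Z}$, and $(A*A)(x)=|\{(a,a')\in A^2 : a+a'=x\}|$. All logarithms are to base $2$. *)

theory Defs
  imports Complex_Main "HOL-Number_Theory.Residues"
begin

definition self_convolution :: "('a, 'b) ring_scheme \<Rightarrow> 'a set \<Rightarrow> 'a \<Rightarrow> nat" where
  "self_convolution R A x = card {(a, a'). a \<in> A \<and> a' \<in> A \<and> a \<oplus>\<^bsub>R\<^esub> a' = x}"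

end

theory Submission
  imports Defs "HOL-Analysis.Kronecker_Approximation_Theorem" "HOL-Analysis.Harmonic_Numbers"
begin

text \<open>
  Suppose that every \<open>x \<in> A + A\<close> has more than \<open>|A|/K\<close> representations, where \<open>K = 2^q\<close>.
  Then \<open>A\<close> has doubling at most \<open>K\<close>, and random sampling in the style of Croot and Sisask yields
  a set \<open>T\<close> of at least \<open>|A| / (2 K^k)\<close> elements, with \<open>k\<close> of order \<open>q^3\<close>, whose differences
  are almost periods of \<open>x \<mapsto> |A \<inter> (A + A - x)| / |A|\<close>. Since \<open>log |A|\<close> exceeds a constant times \<open>q^4\<close>,
  one finds \<open>m = 4q + 3\<close> such differences with \<open>2^m\<close> distinct subset sums; the set \<open>B\<close> of
  these sums satisfies \<open>|A + B| \<le> 4 K^3 |A|\<close>, so by Ruzsa covering \<open>A\<close> lies in fewer than \<open>|A|/K\<close>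
  translates of \<open>B - B\<close>. As \<open>B\<close> has only \<open>m\<close> generators, Dirichlet approximation provides a
  dilation of \<open>\<int>/p\<int>\<close> that makes \<open>B - B\<close> lie in an interval much shorter than \<open>p / |A|^2\<close>. For a
  popular sum two of the first summands now share an interval, and exchanging them moves the sum
  forward a little; iterating, \<open>A + A\<close> would have to go round the whole circle, which needs more than
  \<open>|A|^2\<close> steps.
\<close>

section \<open>Sumsets\<close>

definition sumset :: "'a::ab_group_add set \<Rightarrow> 'a set \<Rightarrow> 'a set" where
  "sumset A B = (\<lambda>(a, b). a + b) ` (A \<times> B)"

definition diffset :: "'a::ab_group_add set \<Rightarrow> 'a set \<Rightarrow> 'a set" where
  "diffset A B = (\<lambda>(a, b). a - b) ` (A \<times> B)"

lemma finite_sumset [simp]: "finite A \<Longrightarrow> finite B \<Longrightarrow> finite (sumset A B)"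
  by (simp add: sumset_def)

lemma finite_diffset [simp]: "finite A \<Longrightarrow> finite B \<Longrightarrow> finite (diffset A B)"
  by (simp add: diffset_def)

lemma sumsetI: "a \<in> A \<Longrightarrow> b \<in> B \<Longrightarrow> a + b \<in> sumset A B"
  by (force simp: sumset_def)

lemma diffsetI: "a \<in> A \<Longrightarrow> b \<in> B \<Longrightarrow> a - b \<in> diffset A B"
  by (force simp: diffset_def)

lemma sumsetE:
  assumes "z \<in> sumset A B"
  obtains a b where "a \<in> A" "b \<in> B" "z = a + b"
  using assms by (auto simp: sumset_def)

lemma diffsetE:
  assumes "z \<in> diffset A B"
  obtains a b where "a \<in> A" "b \<in> B" "z = a - b"
  using assms by (auto simp: diffset_def)

text \<open>The double-counting pattern behind the sumset bounds below: an element with many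
  representations takes up many points of \<open>C\<close>.\<close>

lemma card_mult_le_card_fibres:
  fixes n :: real
  assumes "finite S" "finite C"
    and "\<And>z. z \<in> S \<Longrightarrow> finite (R z)"
    and "\<And>z. z \<in> S \<Longrightarrow> n \<le> card (R z)"
    and "inj_on h (Sigma S R)"
    and "h ` Sigma S R \<subseteq> C"
  shows "card S * n \<le> card C"
proof -
  have "card S * n = (\<Sum>z\<in>S. n)" by simp
  also have "\<dots> \<le> (\<Sum>z\<in>S. real (card (R z)))"
    by (intro sum_mono assms)
  also have "\<dots> = card (Sigma S R)"
    using assms(1,3) by (simp add: card_SigmaI)
  also have "card (Sigma S R) \<le> card C"
    using assms(2,5,6) by (rule card_inj_on_le[rotated 2])
  finally show ?thesis by simp
qed

text \<open>With a representation \<open>z = f z - g z\<close> fixed for each difference, the pair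
  \<open>(f z + w, g z + w)\<close> determines first \<open>z\<close>, as the difference of its
  entries, and then \<open>w\<close>.\<close>

lemma ruzsa_triangle:
  assumes "finite U" "finite V" "finite W"
  shows "card (diffset U V) * card W \<le> card (sumset U W) * card (sumset V W)"
proof -
  have "\<forall>z\<in>diffset U V. \<exists>u v. u \<in> U \<and> v \<in> V \<and> z = u - v"
    by (meson diffsetE)
  then obtain f g where fg: "\<And>z. z \<in> diffset U V \<Longrightarrow> f z \<in> U \<and> g z \<in> V \<and> z = f z - g z"
    by metis
  let ?h = "\<lambda>(z, w). (f z + w, g z + w)"
  have "inj_on ?h (diffset U V \<times> W)"
  proof (rule inj_onI, clarify)
    fix z w z' w'
    assume z: "z \<in> diffset U V" "z' \<in> diffset U V"
      and e: "f z + w = f z' + w'" "g z + w = g z' + w'"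
    have "z = (f z + w) - (g z + w)" using fg[OF z(1)] by simp
    also have "\<dots> = z'" using fg[OF z(2)] by (simp add: e)
    finally show "z = z' \<and> w = w'" using e by simp
  qed
  moreover have "?h ` (diffset U V \<times> W) \<subseteq> sumset U W \<times> sumset V W"
    using fg by (auto intro!: sumsetI)
  ultimately have "card (diffset U V \<times> W) \<le> card (sumset U W \<times> sumset V W)"
    using assms by (intro card_inj_on_le[where f = ?h]) auto
  then show ?thesis by (simp add: card_cartesian_product)
qed

lemma popular_sums_card:
  fixes n :: real and A :: "'a::ab_group_add set"
  assumes "finite A" "finite D" "finite S"
    and "\<And>z. z \<in> S \<Longrightarrow> n \<le> card {a \<in> A. z - a \<in> D}"
  shows "card S * n \<le> real (card A) * card D"
proof -
  have "card S * n \<le> card (A \<times> D)"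
    using assms
    by (intro card_mult_le_card_fibres[where R = "\<lambda>z. {a \<in> A. z - a \<in> D}" and h = "\<lambda>(z, a). (a, z - a)"])
      (auto intro!: inj_onI)
  then show ?thesis by (simp add: card_cartesian_product)
qed

text \<open>Popularity of every sum replaces the Pluennecke--Ruzsa inequality.\<close>

lemma popular_sums_growth:
  fixes K :: real and A :: "'a::ab_group_add set"
  assumes A: "finite A" "A \<noteq> {}" and K: "K > 0"
    and pop: "\<And>z. z \<in> sumset A A \<Longrightarrow> card A / K \<le> card {a \<in> A. z - a \<in> A}"
  shows "card (sumset A A) \<le> K * card A"
    and "card (diffset A A) \<le> K^2 * card A"
    and "card (diffset (sumset A A) A) \<le> K^3 * card A"
proof -
  have pos: "real (card A) > 0" using A by (simp add: card_gt_0_iff)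
  have "card (sumset A A) * (card A / K) \<le> real (card A) * card A"
    using A pop by (intro popular_sums_card) auto
  then show two: "card (sumset A A) \<le> K * card A"
    using pos K by (simp add: field_simps)
  \<comment> \<open>Popularity passes to triple sums: every representation of \<open>a1 + a2\<close>
    becomes one of \<open>z\<close> once \<open>a3\<close> is absorbed into the second
    summand.\<close>
  have "card A / K \<le> card {a \<in> A. z - a \<in> sumset A A}" if "z \<in> sumset A (sumset A A)" for z
  proof -
    from that obtain a1 a2 a3 where a: "a1 \<in> A" "a2 \<in> A" "a3 \<in> A" "z = a1 + (a2 + a3)"
      by (metis sumsetE)
    have "{a \<in> A. (a1 + a2) - a \<in> A} \<subseteq> {a \<in> A. z - a \<in> sumset A A}"
    proof safe
      fix b assume "b \<in> A" "a1 + a2 - b \<in> A"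
      then have "(a1 + a2 - b) + a3 \<in> sumset A A" using a by (intro sumsetI)
      then show "z - b \<in> sumset A A" by (simp add: a algebra_simps)
    qed
    then have "card {a \<in> A. (a1 + a2) - a \<in> A} \<le> card {a \<in> A. z - a \<in> sumset A A}"
      using A by (intro card_mono) auto
    moreover have "card A / K \<le> card {a \<in> A. (a1 + a2) - a \<in> A}"
      using a by (intro pop sumsetI)
    ultimately show ?thesis by linarith
  qed
  then have "card (sumset A (sumset A A)) * (card A / K) \<le> real (card A) * card (sumset A A)"
    using A by (intro popular_sums_card) auto
  then have "card (sumset A (sumset A A)) \<le> K * card (sumset A A)"
    using pos K by (simp add: field_simps)
  also have "\<dots> \<le> K * (K * card A)" using two K by simp
  finally have three: "card (sumset A (sumset A A)) \<le> K^2 * card A"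
    by (simp add: power2_eq_square)
  have "real (card (diffset A A) * card A) \<le> card (sumset A A) * card (sumset A A)"
    unfolding of_nat_mult[symmetric] of_nat_le_iff using A by (intro ruzsa_triangle) auto
  also have "\<dots> \<le> (K * card A) * (K * card A)"
    unfolding of_nat_mult using two K by (intro mult_mono) auto
  finally show "card (diffset A A) \<le> K^2 * card A"
    using pos by (simp add: power2_eq_square mult_ac)
  have comm: "sumset (sumset A A) A = sumset A (sumset A A)"
    by (force simp: sumset_def add.commute image_iff)
  have "real (card (diffset (sumset A A) A) * card A)
      \<le> card (sumset A (sumset A A)) * card (sumset A A)"
    unfolding of_nat_mult[symmetric] of_nat_le_iff comm[symmetric]
    using A by (intro ruzsa_triangle) auto
  also have "\<dots> \<le> (K^2 * card A) * (K * card A)"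
    unfolding of_nat_mult using two three K by (intro mult_mono) auto
  finally show "card (diffset (sumset A A) A) \<le> K^3 * card A"
    using pos by (simp add: power2_eq_square power3_eq_cube mult_ac)
qed

section \<open>Random sampling\<close>

text \<open>For negative \<open>x\<close>, the product of \<open>1 + x + x^2\<close> and
  \<open>1 - x\<close> is \<open>1 - x^3\<close>, which is at least 1, while \<open>1 - x\<close> is
  at most \<open>exp (- x)\<close>.\<close>

lemma exp_le_one_add_add_square:
  fixes x :: real
  assumes "x \<le> 1"
  shows "exp x \<le> 1 + x + x^2"
proof (cases "x \<ge> 0")
  case True
  then show ?thesis using assms by (rule exp_bound)
next
  case False
  have "1 \<le> 1 - x * x^2" using False by (simp add: mult_nonpos_nonneg)
  also have "\<dots> = (1 + x + x^2) * (1 - x)"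
    by (simp add: algebra_simps power2_eq_square)
  also have "\<dots> \<le> (1 + x + x^2) * exp (- x)"
  proof (intro mult_left_mono)
    show "1 - x \<le> exp (- x)" using exp_ge_add_one_self[of "- x"] by simp
    have "0 \<le> (1 + x/2)^2 + 3/4 * x^2" by simp
    also have "\<dots> = 1 + x + x^2" by (simp add: power2_eq_square algebra_simps)
    finally show "0 \<le> 1 + x + x^2" .
  qed
  finally show ?thesis by (simp add: exp_minus field_simps)
qed

text \<open>Chernoff's method: the exponential moment factors over the \<open>k\<close> independent
  coordinates. The parameter \<open>\<eta> / 2\<close> minimises the exponent
  \<open>k * l^2 - l * \<eta> * k\<close> over \<open>l\<close>, with minimum
  \<open>- (k * \<eta>^2 / 4)\<close>.\<close>

lemma sampling_upper_tail:
  fixes y :: "'a \<Rightarrow> real"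
  assumes A: "finite A" and le: "\<And>a. a \<in> A \<Longrightarrow> \<bar>y a\<bar> \<le> 1" and sum0: "(\<Sum>a\<in>A. y a) = 0"
    and eta: "0 \<le> \<eta>" "\<eta> \<le> 1"
  shows "card {s \<in> PiE {..<k} (\<lambda>_. A). \<eta> * k < (\<Sum>i<k. y (s i))}
    \<le> real (card A) ^ k * exp (- (k * \<eta>^2 / 4))"
    (is "real (card ?B) \<le> _")
proof -
  let ?S = "PiE {..<k} (\<lambda>_. A)"
  let ?l = "\<eta> / 2"
  have fin: "finite ?S" using A by (intro finite_PiE) auto
  have "card ?B * exp (?l * (\<eta> * k)) = (\<Sum>s\<in>?B. exp (?l * (\<eta> * k)))" by simp
  also have "\<dots> \<le> (\<Sum>s\<in>?B. exp (?l * (\<Sum>i<k. y (s i))))"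
  proof (rule sum_mono)
    fix s assume "s \<in> ?B"
    then have "\<eta> * k \<le> (\<Sum>i<k. y (s i))" by simp
    then have "?l * (\<eta> * k) \<le> ?l * (\<Sum>i<k. y (s i))"
      using eta(1) by (intro mult_left_mono) simp_all
    then show "exp (?l * (\<eta> * k)) \<le> exp (?l * (\<Sum>i<k. y (s i)))" by (simp only: exp_le_cancel_iff)
  qed
  also have "\<dots> \<le> (\<Sum>s\<in>?S. exp (?l * (\<Sum>i<k. y (s i))))"
    using fin by (intro sum_mono2) auto
  also have "\<dots> = (\<Sum>s\<in>?S. \<Prod>i<k. exp (?l * y (s i)))"
    by (simp add: sum_distrib_left exp_sum)
  also have "\<dots> = (\<Prod>i<k. \<Sum>a\<in>A. exp (?l * y a))"
    using A by (subst prod_sum_PiE) auto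
  also have "\<dots> = (\<Sum>a\<in>A. exp (?l * y a)) ^ k" by simp
  also have "\<dots> \<le> (card A * (1 + ?l^2)) ^ k"
  proof (intro power_mono sum_nonneg)
    have "exp (?l * y a) \<le> 1 + ?l * y a + ?l^2" if "a \<in> A" for a
    proof -
      have "\<bar>?l * y a\<bar> \<le> 1 * 1" using le[OF that] eta unfolding abs_mult by (intro mult_mono) auto
      then have "exp (?l * y a) \<le> 1 + ?l * y a + (?l * y a)^2"
        by (intro exp_le_one_add_add_square) auto
      moreover have "(?l * y a)^2 \<le> ?l^2 * 1"
        unfolding power_mult_distrib using le[OF that]
        by (intro mult_left_mono) (auto simp: abs_square_le_1)
      ultimately show ?thesis by simp
    qed
    \<comment> \<open>The linear term cancels because \<open>y\<close> has mean 0, so only the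
      quadratic one survives.\<close>
    then have "(\<Sum>a\<in>A. exp (?l * y a)) \<le> (\<Sum>a\<in>A. 1 + ?l * y a + ?l^2)"
      by (rule sum_mono)
    also have "\<dots> = card A * (1 + ?l^2) + ?l * (\<Sum>a\<in>A. y a)"
      by (simp add: sum.distrib sum_distrib_left[symmetric] sum_divide_distrib[symmetric] algebra_simps)
    finally show "(\<Sum>a\<in>A. exp (?l * y a)) \<le> card A * (1 + ?l^2)" by (simp add: sum0)
  qed auto
  also have "\<dots> \<le> (card A * exp (?l^2)) ^ k"
    by (intro power_mono mult_left_mono exp_ge_add_one_self) auto
  also have "\<dots> = real (card A) ^ k * exp (k * ?l^2)"
    by (simp add: power_mult_distrib exp_of_nat_mult)
  finally have "card ?B * exp (?l * (\<eta> * k)) * exp (- (?l * (\<eta> * k)))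
      \<le> real (card A) ^ k * exp (k * ?l^2) * exp (- (?l * (\<eta> * k)))"
    by (intro mult_right_mono) auto
  moreover have "exp (k * ?l^2) * exp (- (?l * (\<eta> * k))) = exp (- (k * \<eta>^2 / 4))"
    unfolding exp_add[symmetric] by (simp add: power2_eq_square field_simps)
  ultimately show ?thesis by (simp only: mult.assoc exp_minus_inverse mult_1_right)
qed

lemma sampling_tail:
  fixes y :: "'a \<Rightarrow> real"
  assumes A: "finite A" and le: "\<And>a. a \<in> A \<Longrightarrow> \<bar>y a\<bar> \<le> 1" and sum0: "(\<Sum>a\<in>A. y a) = 0"
    and eta: "0 \<le> \<eta>" "\<eta> \<le> 1"
  shows "card {s \<in> PiE {..<k} (\<lambda>_. A). \<eta> * k < \<bar>\<Sum>i<k. y (s i)\<bar>}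
    \<le> 2 * real (card A) ^ k * exp (- (k * \<eta>^2 / 4))"
proof -
  let ?P = "\<lambda>y. {s \<in> PiE {..<k} (\<lambda>_. A). \<eta> * k < (\<Sum>i<k. y (s i))}"
  have "card {s \<in> PiE {..<k} (\<lambda>_. A). \<eta> * k < \<bar>\<Sum>i<k. y (s i)\<bar>} \<le> card (?P y \<union> ?P (\<lambda>a. - y a))"
  proof (rule card_mono)
    show "finite (?P y \<union> ?P (\<lambda>a. - y a))" using A by (simp add: finite_PiE)
    show "{s \<in> PiE {..<k} (\<lambda>_. A). \<eta> * k < \<bar>\<Sum>i<k. y (s i)\<bar>} \<subseteq> ?P y \<union> ?P (\<lambda>a. - y a)"
      by (simp only: sum_negf abs_real_def) (auto split: if_splits)
  qed
  also have "\<dots> \<le> card (?P y) + card (?P (\<lambda>a. - y a))" by (rule card_Un_le)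
  finally have "real (card {s \<in> PiE {..<k} (\<lambda>_. A). \<eta> * k < \<bar>\<Sum>i<k. y (s i)\<bar>})
      \<le> card (?P y) + real (card (?P (\<lambda>a. - y a)))"
    by (simp only: of_nat_le_iff flip: of_nat_add)
  also have "\<dots> \<le> real (card A) ^ k * exp (- (k * \<eta>^2 / 4)) + real (card A) ^ k * exp (- (k * \<eta>^2 / 4))"
    using assms by (intro add_mono sampling_upper_tail) (auto simp: sum_negf)
  finally show ?thesis by simp
qed

section \<open>Almost periods\<close>

text \<open>Up to normalisation, the convolution of the indicator functions of \<open>D\<close> and
  \<open>-A\<close>. For \<open>D = A + A\<close> it equals 1 on \<open>A\<close>, which is what
  makes its almost periods useful.\<close>

definition translate_density :: "'a::ab_group_add set \<Rightarrow> 'a set \<Rightarrow> 'a \<Rightarrow> real" where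
  "translate_density A D x = card {a \<in> A. x + a \<in> D} / card A"

lemma translate_density_bounds:
  assumes "finite A"
  shows "0 \<le> translate_density A D x" "translate_density A D x \<le> 1"
proof -
  show "0 \<le> translate_density A D x" by (simp add: translate_density_def)
  have "card {a \<in> A. x + a \<in> D} \<le> card A" using assms by (intro card_mono) auto
  then show "translate_density A D x \<le> 1"
    by (auto simp: translate_density_def divide_le_eq_1)
qed

lemma translate_density_eq_0:
  assumes "x \<notin> diffset D A"
  shows "translate_density A D x = 0"
proof -
  have "x + a \<notin> D" if "a \<in> A" for a
    using assms diffsetI[of "x + a" D a A] that by auto
  then have "{a \<in> A. x + a \<in> D} = {}" by auto
  then show ?thesis by (simp add: translate_density_def del: Collect_empty_eq)
qed

text \<open>The Croot--Sisask argument: if one sample \<open>u - t\<close> of \<open>k\<close> points and another one \<open>u - t'\<close>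
  both approximate the density, then so does \<open>u\<close> after translation by \<open>t\<close> and by \<open>t'\<close>; there are
  only \<open>|A + A| ^ k\<close> possible \<open>u\<close>.\<close>

lemma croot_sisask:
  fixes A D :: "'a::ab_group_add set" and \<eta> \<beta> :: real
  assumes A: "finite A" "A \<noteq> {}" and D: "finite D" and eta: "0 \<le> \<eta>" "\<eta> \<le> 1"
    and k: "k > 0" and beta: "\<beta> > 0"
    and small: "4 * card (diffset D A) * exp (- (k * \<eta>^2 / 4)) \<le> \<beta>"
  obtains T where "T \<subseteq> A"
    and "real (card A) ^ (k + 1) / 2 \<le> card T * real (card (sumset A A)) ^ k"
    and "\<And>t t'. t \<in> T \<Longrightarrow> t' \<in> T \<Longrightarrow>
      finite {x. 2 * \<eta> < \<bar>translate_density A D (x + t) - translate_density A D (x + t')\<bar>} \<and>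
      card {x. 2 * \<eta> < \<bar>translate_density A D (x + t) - translate_density A D (x + t')\<bar>} \<le> 2 * \<beta>"
proof -
  define f where "f = translate_density A D"
  define Y where "Y = diffset D A"
  define S where "S = PiE {..<k} (\<lambda>_. A)"
  define g where "g s x = (\<Sum>i<k. of_bool (x + s i \<in> D) :: real) / k" for s x
  define bad where "bad s = {x. \<eta> < \<bar>f x - g s x\<bar>}" for s
  define Good where "Good = {s \<in> S. card (bad s) \<le> \<beta>}"
  have finS: "finite S" using A by (auto simp: S_def intro: finite_PiE)
  have cardS: "card S = card A ^ k" by (simp add: S_def card_PiE)
  have finY: "finite Y" using A D by (simp add: Y_def)
  have posA: "real (card A) > 0" using A by (simp add: card_gt_0_iff)
  \<comment> \<open>Outside \<open>D - A\<close> both the density and every sample estimate vanish,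
    so only finitely many points can be bad.\<close>
  have badY: "bad s \<subseteq> Y" if "s \<in> S" for s
  proof
    fix x assume x: "x \<in> bad s"
    show "x \<in> Y"
    proof (rule ccontr)
      assume n: "x \<notin> Y"
      have "x + s i \<notin> D" if "i < k" for i
        using n diffsetI[of "x + s i" D "s i" A] \<open>s \<in> S\<close> that by (auto simp: Y_def S_def)
      then have "g s x = 0" by (simp add: g_def)
      moreover have "f x = 0" using n by (simp add: f_def Y_def translate_density_eq_0)
      ultimately show False using x eta by (simp add: bad_def)
    qed
  qed
  have tail: "card {s \<in> S. x \<in> bad s} \<le> 2 * real (card A) ^ k * exp (- (k * \<eta>^2 / 4))" for x
  proof -
    define y where "y a = of_bool (x + a \<in> D) - f x" for a
    have "{s \<in> S. x \<in> bad s} = {s \<in> PiE {..<k} (\<lambda>_. A). \<eta> * k < \<bar>\<Sum>i<k. y (s i)\<bar>}"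
    proof -
      have "\<eta> < \<bar>f x - g s x\<bar> \<longleftrightarrow> \<eta> * k < \<bar>\<Sum>i<k. y (s i)\<bar>" for s
      proof -
        have "(\<Sum>i<k. y (s i)) = - (k * (f x - g s x))"
          using k by (simp add: y_def g_def sum_subtractf right_diff_distrib)
        then have "\<bar>\<Sum>i<k. y (s i)\<bar> = k * \<bar>f x - g s x\<bar>" by (simp add: abs_mult)
        then show ?thesis using k by (simp add: mult.commute)
      qed
      then show ?thesis by (simp add: S_def bad_def)
    qed
    moreover have "\<bar>y a\<bar> \<le> 1" for a
      using translate_density_bounds[OF A(1), of D x] by (auto simp: y_def f_def)
    moreover have "(\<Sum>a\<in>A. y a) = 0"
    proof -
      have "(\<Sum>a\<in>A. of_bool (x + a \<in> D)) = real (card {a \<in> A. x + a \<in> D})"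
        using A by (simp add: Int_def)
      then show ?thesis using posA A by (simp add: y_def sum_subtractf f_def translate_density_def)
    qed
    ultimately show ?thesis using sampling_tail[OF A(1), of y \<eta> k] eta by simp
  qed
  \<comment> \<open>Counting pairs of a sample and a bad point in both orders bounds the average
    size of \<open>bad s\<close>. The factor 4 in \<open>small\<close> is the 2 of the two-sided
    tail times the 2 spent on Markov's inequality, which leaves at least half of the samples
    good.\<close>
  have "(\<Sum>s\<in>S. card {x \<in> Y. x \<in> bad s}) = (\<Sum>x\<in>Y. card {s \<in> S. x \<in> bad s})"
    by (rule sum_multicount_gen) (use finS finY in auto)
  moreover have "{x \<in> Y. x \<in> bad s} = bad s" if "s \<in> S" for s using badY[OF that] by auto
  ultimately have "(\<Sum>s\<in>S. card (bad s)) = (\<Sum>x\<in>Y. card {s \<in> S. x \<in> bad s})" by simp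
  then have "(\<Sum>s\<in>S. real (card (bad s))) = (\<Sum>x\<in>Y. real (card {s \<in> S. x \<in> bad s}))"
    by (simp flip: of_nat_sum)
  also have "\<dots> \<le> (\<Sum>x\<in>Y. 2 * real (card A) ^ k * exp (- (k * \<eta>^2 / 4)))"
    by (intro sum_mono tail)
  also have "\<dots> = real (card A) ^ k / 2 * (4 * card Y * exp (- (k * \<eta>^2 / 4)))" by simp
  also have "\<dots> \<le> real (card A) ^ k / 2 * \<beta>"
    using small by (intro mult_left_mono) (auto simp: Y_def)
  finally have total: "(\<Sum>s\<in>S. real (card (bad s))) \<le> real (card A) ^ k / 2 * \<beta>" .
  have "card (S - Good) * \<beta> = (\<Sum>s\<in>S - Good. \<beta>)" by simp
  also have "\<dots> \<le> (\<Sum>s\<in>S - Good. real (card (bad s)))"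
    by (intro sum_mono) (auto simp: Good_def)
  also have "\<dots> \<le> (\<Sum>s\<in>S. real (card (bad s)))"
    using finS by (intro sum_mono2) auto
  also note total
  finally have "card (S - Good) \<le> real (card A) ^ k / 2" using beta by simp
  moreover have "card (S - Good) = card S - card Good" "card Good \<le> card S"
    using finS by (auto intro!: card_Diff_subset card_mono finite_subset[OF _ finS] simp: Good_def)
  ultimately have good: "real (card A) ^ k / 2 \<le> card Good"
    by (simp add: cardS of_nat_diff)
  define U where "U = PiE {..<k} (\<lambda>_. sumset A A)"
  define T where "T u = {t \<in> A. (\<lambda>i\<in>{..<k}. u i - t) \<in> Good}" for u
  have finU: "finite U" using A by (auto simp: U_def intro: finite_PiE)
  have finT: "finite (T u)" for u using A by (simp add: T_def)
  \<comment> \<open>A good sample shifted by \<open>t\<close> is a tuple over \<open>A + A\<close>;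
    since \<open>t\<close> is kept alongside, the sample can be recovered by subtraction.\<close>
  let ?h = "\<lambda>(s, t). (\<lambda>i\<in>{..<k}. s i + t, t)"
  have unshift: "(\<lambda>i\<in>{..<k}. (\<lambda>i\<in>{..<k}. s i + t) i - t) = s" if "s \<in> S" for s t
  proof -
    have "(\<lambda>i\<in>{..<k}. (\<lambda>i\<in>{..<k}. s i + t) i - t) = restrict s {..<k}"
      by (auto simp: restrict_def fun_eq_iff)
    also have "\<dots> = s" using that unfolding S_def by (rule PiE_restrict)
    finally show ?thesis .
  qed
  have GS: "Good \<subseteq> S" by (auto simp: Good_def)
  have "inj_on ?h (Good \<times> A)"
  proof (rule inj_onI)
    fix z z' assume z: "z \<in> Good \<times> A" "z' \<in> Good \<times> A" "?h z = ?h z'"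
    obtain s t s' t' where [simp]: "z = (s, t)" "z' = (s', t')" by (metis surj_pair)
    have "t = t'" "s \<in> S" "s' \<in> S" using z GS by auto
    moreover have "(\<lambda>i\<in>{..<k}. s i + t) = (\<lambda>i\<in>{..<k}. s' i + t')"
      using arg_cong[OF z(3), of fst] by simp
    ultimately have "s = s'" by (metis unshift)
    then show "z = z'" using \<open>t = t'\<close> by simp
  qed
  moreover have "?h ` (Good \<times> A) \<subseteq> Sigma U T"
  proof clarify
    fix s t assume s: "s \<in> Good" "t \<in> A"
    then have "s \<in> S" using GS by auto
    then have "(\<lambda>i\<in>{..<k}. s i + t) \<in> U"
      using s by (auto simp: U_def S_def intro!: sumsetI)
    moreover have "t \<in> T (\<lambda>i\<in>{..<k}. s i + t)"
      using s unshift[OF \<open>s \<in> S\<close>, of t] by (simp add: T_def)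
    ultimately show "(\<lambda>i\<in>{..<k}. s i + t) \<in> U \<and> t \<in> T (\<lambda>i\<in>{..<k}. s i + t)" by simp
  qed
  ultimately have "card (Good \<times> A) \<le> card (Sigma U T)"
    using finU finT by (intro card_inj_on_le[where f = ?h]) auto
  then have "card Good * card A \<le> (\<Sum>u\<in>U. card (T u))"
    using finU finT by (simp add: card_cartesian_product card_SigmaI)
  then have pairs: "real (card Good) * card A \<le> (\<Sum>u\<in>U. real (card (T u)))"
    by (simp flip: of_nat_sum of_nat_mult)
  have goodA: "real (card A) ^ (k + 1) / 2 \<le> card Good * real (card A)"
    using mult_right_mono[OF good, of "card A"] by (simp add: mult.commute)
  have "U \<noteq> {}" using A by (auto simp: U_def PiE_eq_empty_iff sumset_def)
  have cardU: "card U = card (sumset A A) ^ k" by (simp add: U_def card_PiE)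
  \<comment> \<open>Averaging over the tuples in \<open>U\<close>: some \<open>u\<close> arises from
    many shifts \<open>t\<close>.\<close>
  have "\<exists>u\<in>U. real (card A) ^ (k + 1) / 2 \<le> card (T u) * real (card U)"
  proof (rule ccontr)
    assume "\<not> ?thesis"
    then have "(\<Sum>u\<in>U. card (T u) * real (card U)) < (\<Sum>u\<in>U. real (card A) ^ (k + 1) / 2)"
      using finU \<open>U \<noteq> {}\<close> by (intro sum_strict_mono) (auto simp: not_le)
    then have "card U * (\<Sum>u\<in>U. real (card (T u))) < card U * (real (card A) ^ (k + 1) / 2)"
      by (simp add: sum_distrib_left mult.commute)
    then have "(\<Sum>u\<in>U. real (card (T u))) < real (card A) ^ (k + 1) / 2"
      using mult_less_cancel_left_pos[of "real (card U)"] finU \<open>U \<noteq> {}\<close> by (simp add: card_gt_0_iff)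
    then show False using pairs goodA by linarith
  qed
  then obtain u where u: "u \<in> U" "real (card A) ^ (k + 1) / 2 \<le> card (T u) * real (card U)"
    by blast
  show thesis
  proof
    show "T u \<subseteq> A" by (auto simp: T_def)
    show "real (card A) ^ (k + 1) / 2 \<le> card (T u) * real (card (sumset A A)) ^ k"
      using u by (simp add: cardU)
    fix t t' assume t: "t \<in> T u" "t' \<in> T u"
    define s where "s r = (\<lambda>i\<in>{..<k}. u i - r)" for r
    have s: "s t \<in> Good" "s t' \<in> Good" using t by (auto simp: s_def T_def)
    \<comment> \<open>The estimate that \<open>u - r\<close> gives at \<open>x + r\<close> does not
      depend on \<open>r\<close>, so \<open>g u x\<close> can be compared with the density at both
      \<open>x + t\<close> and \<open>x + t'\<close>.\<close>
    have shift: "g (s r) (x + r) = g u x" for r x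
      by (simp add: g_def s_def)
    let ?E = "{x. 2 * \<eta> < \<bar>f (x + t) - f (x + t')\<bar>}"
    let ?F = "(\<lambda>y. y - t) ` bad (s t) \<union> (\<lambda>y. y - t') ` bad (s t')"
    have sub: "?E \<subseteq> ?F"
    proof
      fix x assume "x \<in> ?E"
      then have "\<eta> < \<bar>f (x + t) - g u x\<bar> \<or> \<eta> < \<bar>f (x + t') - g u x\<bar>" by auto
      then have "x + t \<in> bad (s t) \<or> x + t' \<in> bad (s t')" by (simp add: bad_def shift)
      then show "x \<in> ?F" by (auto intro: image_eqI[where x = "x + t"] image_eqI[where x = "x + t'"])
    qed
    have fin: "finite ?F"
      using finite_subset[OF badY finY] s GS by auto
    have "card ?E \<le> card ?F" by (intro card_mono fin sub)
    also have "\<dots> \<le> card ((\<lambda>y. y - t) ` bad (s t)) + card ((\<lambda>y. y - t') ` bad (s t'))"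
      by (rule card_Un_le)
    also have "\<dots> = card (bad (s t)) + card (bad (s t'))"
      by (simp add: card_image inj_on_def)
    finally have "real (card ?E) \<le> real (card (bad (s t))) + card (bad (s t'))"
      by (simp only: of_nat_le_iff flip: of_nat_add)
    also have "\<dots> \<le> \<beta> + \<beta>" using s by (intro add_mono) (auto simp: Good_def)
    finally show "finite {x. 2 * \<eta> < \<bar>translate_density A D (x + t) - translate_density A D (x + t')\<bar>} \<and>
      card {x. 2 * \<eta> < \<bar>translate_density A D (x + t) - translate_density A D (x + t')\<bar>} \<le> 2 * \<beta>"
      using finite_subset[OF sub fin] by (simp add: f_def)
  qed
qed

section \<open>Cubes of subset sums\<close>

fun subset_sums :: "'a::ab_group_add list \<Rightarrow> 'a set" where
  "subset_sums [] = {0}"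
| "subset_sums (b # bs) = subset_sums bs \<union> (\<lambda>y. b + y) ` subset_sums bs"

lemma finite_subset_sums [simp]: "finite (subset_sums bs)"
  by (induction bs) auto

text \<open>Generators are chosen greedily: with \<open>S\<close> the sums so far,
  \<open>S - S\<close> has at most \<open>4 ^ m\<close> elements, so some \<open>b\<close> in
  \<open>E\<close> avoids it, and then \<open>S\<close> and \<open>b + S\<close> are
  disjoint.\<close>

lemma exists_distinct_subset_sums:
  fixes E :: "'a::ab_group_add set"
  assumes "finite E" "4 ^ m < card E"
  shows "\<exists>bs. length bs = m \<and> set bs \<subseteq> E \<and> card (subset_sums bs) = 2 ^ m"
  using assms(2)
proof (induction m)
  case 0
  then show ?case by simp
next
  case (Suc m)
  then obtain bs where bs: "length bs = m" "set bs \<subseteq> E" "card (subset_sums bs) = 2 ^ m"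
    by auto
  let ?S = "subset_sums bs"
  have "card (diffset ?S ?S) \<le> card (?S \<times> ?S)"
    unfolding diffset_def by (intro card_image_le) simp
  also have "\<dots> = 4 ^ m" by (simp add: card_cartesian_product bs power_mult_distrib[symmetric])
  also have "\<dots> < card E" using Suc.prems by (simp add: less_le_trans)
  finally have "card (diffset ?S ?S) < card E" .
  then obtain b where b: "b \<in> E" "b \<notin> diffset ?S ?S"
    by (metis card_mono finite_diffset finite_subset_sums not_less subsetI)
  have "?S \<inter> (\<lambda>y. b + y) ` ?S = {}"
  proof (rule ccontr)
    assume "?S \<inter> (\<lambda>y. b + y) ` ?S \<noteq> {}"
    then obtain y y' where "y \<in> ?S" "y' \<in> ?S" "y = b + y'" by auto
    then show False using b diffsetI[of y ?S y' ?S] by simp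
  qed
  then have "card (subset_sums (b # bs)) = 2 ^ Suc m"
    by (simp add: card_Un_disjoint card_image inj_on_def bs)
  then show ?case using bs b by (intro exI[of _ "b # bs"]) auto
qed

text \<open>Triangle inequality along the generators that occur in \<open>y\<close>: each one adds
  \<open>c\<close> to the error and, up to translation, one more exceptional set of size at most
  \<open>\<beta>\<close>.\<close>

lemma almost_period_subset_sums:
  fixes f :: "'a::ab_group_add \<Rightarrow> real" and c \<beta> :: real
  assumes "0 \<le> c" "0 \<le> \<beta>"
    and "\<And>b. b \<in> set bs \<Longrightarrow> finite {x. c < \<bar>f (x + b) - f x\<bar>} \<and> card {x. c < \<bar>f (x + b) - f x\<bar>} \<le> \<beta>"
    and "y \<in> subset_sums bs"
  shows "finite {x. length bs * c < \<bar>f (x + y) - f x\<bar>} \<and>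
    card {x. length bs * c < \<bar>f (x + y) - f x\<bar>} \<le> length bs * \<beta>"
  using assms(3,4)
proof (induction bs arbitrary: y)
  case Nil
  then show ?case by simp
next
  case (Cons b bs)
  let ?n = "real (length bs)"
  let ?E = "\<lambda>c y. {x. c < \<bar>f (x + y) - f x\<bar>}"
  have IH: "finite (?E (?n * c) z) \<and> card (?E (?n * c) z) \<le> ?n * \<beta>" if "z \<in> subset_sums bs" for z
    using Cons.IH[OF Cons.prems(1) that] by simp
  have b: "finite (?E c b)" "card (?E c b) \<le> \<beta>" using Cons.prems(1)[of b] by auto
  consider "y \<in> subset_sums bs" | y' where "y' \<in> subset_sums bs" "y = b + y'"
    using Cons.prems(2) by auto
  then have "\<exists>F. finite F \<and> ?E ((?n + 1) * c) y \<subseteq> F \<and> card F \<le> (?n + 1) * \<beta>"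
  proof cases
    case 1
    have "?n * c \<le> (?n + 1) * c" using assms by (intro mult_right_mono) auto
    then have "?E ((?n + 1) * c) y \<subseteq> ?E (?n * c) y" by auto
    moreover have "?n * \<beta> \<le> (?n + 1) * \<beta>" using assms by (intro mult_right_mono) auto
    ultimately show ?thesis using IH[OF 1] by (intro exI[of _ "?E (?n * c) y"]) auto
  next
    case 2
    let ?F = "(\<lambda>z. z - b) ` ?E (?n * c) y' \<union> ?E c b"
    have "?E ((?n + 1) * c) y \<subseteq> ?F"
    proof
      fix x assume "x \<in> ?E ((?n + 1) * c) y"
      then have "?n * c + c < \<bar>f (x + b + y') - f x\<bar>" by (simp add: 2 algebra_simps)
      then have "?n * c < \<bar>f (x + b + y') - f (x + b)\<bar> \<or> c < \<bar>f (x + b) - f x\<bar>" by linarith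
      then show "x \<in> ?F" by (auto intro: image_eqI[where x = "x + b"])
    qed
    moreover have "finite ?F" using IH[OF 2(1)] b by simp
    moreover have "real (card ?F) \<le> (?n + 1) * \<beta>"
    proof -
      have "card ?F \<le> card ((\<lambda>z. z - b) ` ?E (?n * c) y') + card (?E c b)" by (rule card_Un_le)
      also have "\<dots> = card (?E (?n * c) y') + card (?E c b)"
        by (simp add: card_image inj_on_def)
      finally have "real (card ?F) \<le> real (card (?E (?n * c) y')) + card (?E c b)"
        by (simp only: of_nat_le_iff flip: of_nat_add)
      also have "\<dots> \<le> ?n * \<beta> + \<beta>" using IH[OF 2(1)] b by (intro add_mono) auto
      finally show ?thesis by (simp add: algebra_simps)
    qed
    ultimately show ?thesis by blast
  qed
  then obtain F where F: "finite F" "?E ((?n + 1) * c) y \<subseteq> F" "card F \<le> (?n + 1) * \<beta>" by blast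
  then have "finite (?E ((?n + 1) * c) y)" "card (?E ((?n + 1) * c) y) \<le> card F"
    by (auto intro: finite_subset card_mono)
  then have "finite (?E ((?n + 1) * c) y) \<and> card (?E ((?n + 1) * c) y) \<le> (?n + 1) * \<beta>"
    using F(3) by linarith
  moreover have "real (length (b # bs)) = ?n + 1" by simp
  ultimately show ?case by metis
qed

section \<open>Covering \<open>A\<close> by translates of \<open>B - B\<close>\<close>

text \<open>Take \<open>X\<close> maximal such that the translates \<open>x + B\<close> are pairwise
  disjoint: a point outside \<open>X + B - B\<close> could still be added. The induction over
  \<open>A\<close> carries out this greedy choice, and disjointness bounds the number of
  translates.\<close>

lemma ruzsa_covering:
  fixes A B :: "'a::ab_group_add set"
  assumes "finite A" "finite B" "B \<noteq> {}"
  obtains X where "X \<subseteq> A" "card X * card B \<le> card (sumset A B)"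
    "\<And>a. a \<in> A \<Longrightarrow> \<exists>x\<in>X. \<exists>b\<in>B. \<exists>b'\<in>B. a = x + b - b'"
proof -
  have "\<exists>X\<subseteq>A. inj_on (\<lambda>(x, b). x + b) (X \<times> B) \<and> (\<forall>a\<in>A. \<exists>x\<in>X. \<exists>b\<in>B. \<exists>b'\<in>B. a = x + b - b')"
    using assms(1)
  proof (induction rule: finite_induct)
    case empty
    then show ?case by auto
  next
    case (insert a A)
    then obtain X where X: "X \<subseteq> A" "inj_on (\<lambda>(x, b). x + b) (X \<times> B)"
      "\<forall>a\<in>A. \<exists>x\<in>X. \<exists>b\<in>B. \<exists>b'\<in>B. a = x + b - b'" by blast
    show ?case
    proof (cases "\<exists>x\<in>X. \<exists>b\<in>B. \<exists>b'\<in>B. a = x + b - b'")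
      case True
      then show ?thesis using X by (intro exI[of _ X]) auto
    next
      case False
      then have no: "a + b' \<noteq> x + b" if "x \<in> X" "b \<in> B" "b' \<in> B" for x b b'
        using that by (metis add_diff_cancel_right')
      have "inj_on (\<lambda>(x, b). x + b) (insert a X \<times> B)"
      proof (rule inj_onI, clarify)
        fix x b x' b'
        assume h: "x \<in> insert a X" "x' \<in> insert a X" "b \<in> B" "b' \<in> B" "x + b = x' + b'"
        then have "x \<in> X \<and> x' \<in> X \<or> x = x'" using no by force
        then show "x = x' \<and> b = b'"
          using h inj_onD[OF X(2), of "(x, b)" "(x', b')"] by auto
      qed
      moreover have "\<exists>x\<in>insert a X. \<exists>b\<in>B. \<exists>b'\<in>B. a = x + b - b'" using assms(3) by auto
      ultimately show ?thesis using X by (intro exI[of _ "insert a X"]) auto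
    qed
  qed
  then obtain X where X: "X \<subseteq> A" "inj_on (\<lambda>(x, b). x + b) (X \<times> B)"
    "\<forall>a\<in>A. \<exists>x\<in>X. \<exists>b\<in>B. \<exists>b'\<in>B. a = x + b - b'" by blast
  have "card (X \<times> B) \<le> card (sumset A B)"
    using X assms by (intro card_inj_on_le[OF X(2)]) (auto intro!: sumsetI)
  then show thesis using that X by (simp add: card_cartesian_product)
qed

text \<open>The set \<open>P\<close> where the density is at least 1/2 has at most
  \<open>2 |D|\<close> elements. For \<open>z = a + b\<close>, at least \<open>|A| / 2\<close>
  points \<open>x\<close> of \<open>A\<close> put \<open>x + b\<close> in \<open>P\<close>, and each
  yields a representation \<open>z = (x + b) + (a - x)\<close> by \<open>P\<close> and
  \<open>A - A\<close>.\<close>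

lemma almost_period_sumset_growth:
  fixes A D B :: "'a::ab_group_add set"
  assumes A: "finite A" "A \<noteq> {}" and D: "finite D" and B: "finite B"
    and half: "\<And>b. b \<in> B \<Longrightarrow> card A / 2 \<le> card {x \<in> A. 1 / 2 \<le> translate_density A D (x + b)}"
  shows "card (sumset A B) * real (card A) \<le> 4 * real (card D) * card (diffset A A)"
proof -
  define P where "P = {x. 1 / 2 \<le> translate_density A D x}"
  have posA: "real (card A) > 0" using A by (simp add: card_gt_0_iff)
  have "P \<subseteq> diffset D A"
  proof
    fix x assume "x \<in> P"
    then show "x \<in> diffset D A"
      using translate_density_eq_0[of x D A] by (force simp: P_def)
  qed
  then have finP: "finite P" using A D by (auto intro: finite_subset)
  have "card P * (card A / 2) \<le> card (A \<times> D)"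
  proof (rule card_mult_le_card_fibres[where R = "\<lambda>z. {a \<in> A. z + a \<in> D}" and h = "\<lambda>(z, a). (a, z + a)"])
    show "card A / 2 \<le> card {a \<in> A. z + a \<in> D}" if "z \<in> P" for z
      using that posA by (simp add: P_def translate_density_def field_simps)
  qed (use A D finP in \<open>auto intro!: inj_onI\<close>)
  then have cardP: "card P \<le> 2 * real (card D)"
    using posA by (simp add: card_cartesian_product)
  have "\<forall>z\<in>sumset A B. \<exists>a b. a \<in> A \<and> b \<in> B \<and> z = a + b"
    by (meson sumsetE)
  then obtain f g where fg: "\<And>z. z \<in> sumset A B \<Longrightarrow> f z \<in> A \<and> g z \<in> B \<and> z = f z + g z"
    by metis
  have "card (sumset A B) * (card A / 2) \<le> card (P \<times> diffset A A)"
  proof (rule card_mult_le_card_fibres[where R = "\<lambda>z. {x \<in> A. x + g z \<in> P}"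
        and h = "\<lambda>(z, x). (x + g z, f z - x)"])
    show "card A / 2 \<le> card {x \<in> A. x + g z \<in> P}" if "z \<in> sumset A B" for z
      using half[of "g z"] fg[OF that] by (simp add: P_def)
    show "inj_on (\<lambda>(z, x). (x + g z, f z - x)) (SIGMA z:sumset A B. {x \<in> A. x + g z \<in> P})"
    proof (rule inj_onI, clarify)
      fix z x z' x'
      assume z: "z \<in> sumset A B" "z' \<in> sumset A B"
        and e: "x + g z = x' + g z'" "f z - x = f z' - x'"
      have "z = (x + g z) + (f z - x)" using fg[OF z(1)] by (simp add: add.commute)
      also have "\<dots> = (x' + g z') + (f z' - x')" by (simp only: e)
      also have "\<dots> = z'" using fg[OF z(2)] by (simp add: add.commute)
      finally show "z = z' \<and> x = x'" using e by simp
    qed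
    show "(\<lambda>(z, x). (x + g z, f z - x)) ` (SIGMA z:sumset A B. {x \<in> A. x + g z \<in> P}) \<subseteq> P \<times> diffset A A"
      using fg by (auto intro!: diffsetI)
  qed (use A B finP in auto)
  also have "\<dots> = real (card P) * card (diffset A A)" by (simp add: card_cartesian_product)
  also have "\<dots> \<le> 2 * real (card D) * card (diffset A A)"
    using cardP by (intro mult_right_mono) auto
  finally show ?thesis by simp
qed

text \<open>With \<open>k = 64 m^2 (2m + 4)\<close> and \<open>\<eta> = 1/(4m)\<close> the exponent \<open>k \<eta>^2 / 4\<close> of the tail bound is
  \<open>2m + 4\<close>. The error \<open>2\<eta>\<close> per almost period sums to \<open>1/2\<close> over \<open>m\<close> of them, and the exceptional
  sets of size \<open>|A| / (2m)\<close> to \<open>|A|/2\<close>.\<close>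

lemma sample_size_bound:
  fixes q m :: nat and a :: real
  assumes "m = 4 * q + 3" "a \<ge> 0"
  shows "4 * ((2 ^ q) ^ 3 * a) * exp (- (real (64 * m^2 * (2 * m + 4)) * (1 / (4 * real m))^2 / 4))
    \<le> a / (4 * real m)"
proof -
  have m: "real m > 0" using assms by simp
  have e: "real (64 * m^2 * (2 * m + 4)) * (1 / (4 * real m))^2 / 4 = real (2 * m + 4)"
    using m by (simp add: field_simps power2_eq_square)
  have "16 * real m * (2 ^ q) ^ 3 \<le> exp (2 * m + 4)"
  proof -
    have "16 * real m * (2 ^ q) ^ 3 \<le> 2 ^ 4 * 2 ^ m * 2 ^ (3 * q)"
      using of_nat_mono[of m "2 ^ m", where 'a = real] less_exp[of m]
      by (intro mult_mono) (auto simp flip: power_mult simp: mult.commute)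
    also have "\<dots> = (2::real) ^ (4 + m + 3 * q)" by (simp add: power_add)
    also have "\<dots> \<le> 2 ^ (2 * m + 4)" using assms by (intro power_increasing) auto
    also have "\<dots> \<le> exp 1 ^ (2 * m + 4)"
      using exp_ge_add_one_self[of 1] by (intro power_mono) auto
    also have "\<dots> = exp (2 * m + 4)" by (simp flip: exp_of_nat_mult)
    finally show ?thesis .
  qed
  then have "16 * real m * (2 ^ q) ^ 3 * exp (- real (2 * m + 4)) \<le> exp (2 * m + 4) * exp (- real (2 * m + 4))"
    by (rule mult_right_mono) simp
  then have "16 * real m * (2 ^ q) ^ 3 * exp (- real (2 * m + 4)) \<le> 1"
    by (simp only: exp_minus_inverse)
  then have "16 * real m * (2 ^ q) ^ 3 * exp (- real (2 * m + 4)) * a \<le> 1 * a"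
    using assms(2) by (rule mult_right_mono)
  then show ?thesis unfolding e using m by (simp add: field_simps)
qed

text \<open>Source of the constant 60000. In the exponent, \<open>q * k + 1\<close> is the loss from
  sampling and \<open>2 * m\<close> pays for \<open>4 ^ m\<close>; the first product costs at most
  \<open>56448 * q ^ 4\<close>, the linear terms at most \<open>15 * q ^ 4\<close>.\<close>

lemma exponent_bound:
  fixes q m :: nat
  assumes "q \<ge> 1" "m = 4 * q + 3"
  shows "q * (64 * m^2 * (2 * m + 4)) + 2 * m + 1 \<le> 60000 * q ^ 4"
proof -
  have m: "m \<le> 7 * q" "2 * m + 4 \<le> 18 * q" using assms by auto
  have "q * (64 * m^2 * (2 * m + 4)) \<le> q * (64 * (7 * q)^2 * (18 * q))"
    using m by (intro mult_mono power_mono order_refl) auto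
  also have "\<dots> = 56448 * q ^ 4" by (simp add: power2_eq_square power4_eq_xxxx)
  finally have "q * (64 * m^2 * (2 * m + 4)) \<le> 56448 * q ^ 4" .
  moreover have "2 * m + 1 \<le> 15 * q" using assms by auto
  moreover have "q \<le> q ^ 4" using assms by (intro self_le_power) auto
  ultimately show ?thesis by linarith
qed

proposition popular_sums_cover:
  fixes A :: "'a::ab_group_add set" and q :: nat
  assumes A: "finite A" "A \<noteq> {}" and q: "q \<ge> 1" and large: "2 ^ (60000 * q ^ 4) < real (card A)"
    and pop: "\<And>z. z \<in> sumset A A \<Longrightarrow> card A / 2 ^ q \<le> card {a \<in> A. z - a \<in> A}"
  obtains bs X where "length bs = 4 * q + 3" "X \<subseteq> A" "card X < card A / 2 ^ q"
    "\<And>a. a \<in> A \<Longrightarrow> \<exists>x\<in>X. \<exists>y\<in>subset_sums bs. \<exists>y'\<in>subset_sums bs. a = x + y - y'"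
proof -
  define K where "K = (2::real) ^ q"
  \<comment> \<open>This makes \<open>2 ^ m = 8 * K^4\<close>, larger by a factor
    \<open>2 * K\<close> than the growth \<open>4 * K^3\<close> of \<open>A + B\<close>; the spare 2
    gives the strict bound on \<open>card X\<close>.\<close>
  define m where "m = 4 * q + 3"
  define k where "k = 64 * m^2 * (2 * m + 4)"
  define \<eta> where "\<eta> = 1 / (4 * real m)"
  define \<beta> where "\<beta> = card A / (4 * real m)"
  define D where "D = sumset A A"
  have K: "K > 0" by (simp add: K_def)
  have m: "real m \<ge> 1" by (simp add: m_def)
  have posA: "real (card A) > 0" using A by (simp add: card_gt_0_iff)
  have finD: "finite D" using A by (simp add: D_def)
  note growth = popular_sums_growth[OF A K, folded D_def]
  have g1: "card D \<le> K * card A" and g2: "card (diffset A A) \<le> K^2 * card A"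
    and g3: "card (diffset D A) \<le> K^3 * card A"
    using growth pop by (auto simp: K_def D_def)
  have beta: "\<beta> > 0" using posA m by (simp add: \<beta>_def)
  have eta: "0 \<le> \<eta>" "\<eta> \<le> 1" using m by (auto simp: \<eta>_def)
  have kpos: "k > 0" by (simp add: k_def m_def)
  have "4 * card (diffset D A) * exp (- (k * \<eta>^2 / 4)) \<le> 4 * (K^3 * card A) * exp (- (k * \<eta>^2 / 4))"
    using g3 by simp
  also have "\<dots> \<le> \<beta>"
    unfolding K_def k_def \<eta>_def \<beta>_def by (rule sample_size_bound) (auto simp: m_def)
  finally have small: "4 * card (diffset D A) * exp (- (k * \<eta>^2 / 4)) \<le> \<beta>" .
  obtain T where T: "T \<subseteq> A" "real (card A) ^ (k + 1) / 2 \<le> card T * real (card D) ^ k"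
    "\<And>t t'. t \<in> T \<Longrightarrow> t' \<in> T \<Longrightarrow>
      finite {x. 2 * \<eta> < \<bar>translate_density A D (x + t) - translate_density A D (x + t')\<bar>} \<and>
      card {x. 2 * \<eta> < \<bar>translate_density A D (x + t) - translate_density A D (x + t')\<bar>} \<le> 2 * \<beta>"
    using croot_sisask[OF A finD eta kpos beta small, folded D_def] by blast
  \<comment> \<open>Sampling costs a factor \<open>2 * K ^ k\<close>; what remains of
    \<open>|A|\<close> must still exceed the \<open>4 ^ m\<close> required by the greedy choice of
    generators.\<close>
  have Tlarge: "4 ^ m < card T"
  proof -
    have "real (card A) ^ (k + 1) / 2 \<le> card T * (K * card A) ^ k"
      using T(2) g1 by (meson mult_left_mono of_nat_0_le_iff order_trans power_mono)
    then have "real (card A) ^ k * card A \<le> real (card A) ^ k * (card T * (2 * K ^ k))"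
      by (simp add: power_mult_distrib mult_ac)
    then have "card A \<le> card T * (2 * K ^ k)" using posA by simp
    also have "2 * K ^ k = 2 ^ (q * k + 1)" by (simp add: K_def power_mult)
    finally have "card A \<le> card T * (2::real) ^ (q * k + 1)" .
    moreover have "(2::real) ^ (q * k + 1) * 4 ^ m \<le> 2 ^ (60000 * q ^ 4)"
    proof -
      have "(4::real) ^ m = 2 ^ (2 * m)" by (simp add: power_mult)
      then have "(2::real) ^ (q * k + 1) * 4 ^ m = 2 ^ (q * k + 2 * m + 1)"
        by (simp add: power_add)
      also have "\<dots> \<le> 2 ^ (60000 * q ^ 4)"
        using exponent_bound[OF q m_def] by (intro power_increasing) (auto simp: k_def)
      finally show ?thesis .
    qed
    ultimately have "(2::real) ^ (q * k + 1) * 4 ^ m < real (card T) * 2 ^ (q * k + 1)"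
      using large by linarith
    then have "(4::real) ^ m < card T" by (simp add: mult.commute)
    then have "real (4 ^ m) < real (card T)" by simp
    then show ?thesis by (simp only: of_nat_less_iff)
  qed
  then obtain t0 where t0: "t0 \<in> T" by (metis all_not_in_conv card.empty not_less0)
  \<comment> \<open>Fixing a base point \<open>t0\<close> turns the comparison of two translates of
    the density into an almost period \<open>t - t0\<close>.\<close>
  define E where "E = (\<lambda>t. t - t0) ` T"
  have finT: "finite T" using T(1) A finite_subset by blast
  have "card E = card T" by (simp add: E_def card_image inj_on_def)
  then obtain bs where bs: "length bs = m" "set bs \<subseteq> E" "card (subset_sums bs) = 2 ^ m"
    using exists_distinct_subset_sums[of E m] Tlarge finT by (auto simp: E_def)
  define B where "B = subset_sums bs"
  have dens1: "translate_density A D a = 1" if "a \<in> A" for a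
  proof -
    have "{b \<in> A. a + b \<in> D} = A" using that by (auto simp: D_def intro: sumsetI)
    then show ?thesis using posA by (simp add: translate_density_def)
  qed
  \<comment> \<open>On \<open>A\<close> the density is 1, so a change of at most 1/2 keeps it at
    least 1/2; the exceptional points number at most \<open>|A| / 2\<close>.\<close>
  have half: "card A / 2 \<le> card {x \<in> A. 1 / 2 \<le> translate_density A D (x + b)}" if "b \<in> B" for b
  proof -
    let ?f = "translate_density A D"
    let ?N = "{x. length bs * (2 * \<eta>) < \<bar>?f (x + b) - ?f x\<bar>}"
    have ap: "finite ?N \<and> card ?N \<le> length bs * (2 * \<beta>)"
    proof (rule almost_period_subset_sums)
      fix e assume "e \<in> set bs"
      then obtain t where t: "t \<in> T" "e = t - t0" using bs(2) by (auto simp: E_def)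
      let ?M = "{x. 2 * \<eta> < \<bar>?f (x + t) - ?f (x + t0)\<bar>}"
      have "{x. 2 * \<eta> < \<bar>?f (x + e) - ?f x\<bar>} = (\<lambda>x. x + t0) ` ?M"
      proof (intro subset_antisym subsetI)
        fix x assume "x \<in> {x. 2 * \<eta> < \<bar>?f (x + e) - ?f x\<bar>}"
        then have "x - t0 \<in> ?M" by (simp add: t algebra_simps)
        then show "x \<in> (\<lambda>x. x + t0) ` ?M" by (auto intro: image_eqI[where x = "x - t0"])
      next
        fix x assume "x \<in> (\<lambda>x. x + t0) ` ?M"
        then show "x \<in> {x. 2 * \<eta> < \<bar>?f (x + e) - ?f x\<bar>}"
          by (auto simp: t algebra_simps)
      qed
      then show "finite {x. 2 * \<eta> < \<bar>?f (x + e) - ?f x\<bar>} \<and>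
          card {x. 2 * \<eta> < \<bar>?f (x + e) - ?f x\<bar>} \<le> 2 * \<beta>"
        using T(3)[OF t(1) t0] by (simp add: card_image inj_on_def)
    qed (use eta beta that in \<open>auto simp: B_def\<close>)
    have e: "length bs * (2 * \<eta>) = 1 / 2" "length bs * (2 * \<beta>) = card A / 2"
      using m by (auto simp: bs \<eta>_def \<beta>_def)
    have N: "finite ?N" "card ?N \<le> card A / 2" "?N = {x. 1 / 2 < \<bar>?f (x + b) - ?f x\<bar>}"
      using ap unfolding e by simp_all
    have "A \<subseteq> {x \<in> A. 1 / 2 \<le> ?f (x + b)} \<union> ?N"
      unfolding N(3)
    proof
      fix x assume x: "x \<in> A"
      then have "1 / 2 \<le> ?f (x + b) \<or> 1 / 2 < \<bar>?f (x + b) - ?f x\<bar>" using dens1[OF x] by linarith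
      then show "x \<in> {x \<in> A. 1 / 2 \<le> ?f (x + b)} \<union> {x. 1 / 2 < \<bar>?f (x + b) - ?f x\<bar>}"
        using x by blast
    qed
    then have "card A \<le> card ({x \<in> A. 1 / 2 \<le> ?f (x + b)} \<union> ?N)"
      using A N(1) by (intro card_mono) auto
    also have "\<dots> \<le> card {x \<in> A. 1 / 2 \<le> ?f (x + b)} + card ?N" by (rule card_Un_le)
    finally have "real (card A) \<le> real (card {x \<in> A. 1 / 2 \<le> ?f (x + b)}) + card ?N"
      by (simp only: of_nat_le_iff flip: of_nat_add)
    then show ?thesis using N(2) by linarith
  qed
  have finB: "finite B" "B \<noteq> {}" using bs(3) by (auto simp: B_def)
  have "card (sumset A B) * real (card A) \<le> 4 * real (card D) * card (diffset A A)"
    by (rule almost_period_sumset_growth[OF A finD finB(1) half])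
  also have "\<dots> \<le> 4 * (K * card A) * (K^2 * card A)"
    using g1 g2 K by (intro mult_mono) auto
  finally have AB: "card (sumset A B) \<le> 4 * K^3 * card A"
    using posA by (simp add: power2_eq_square power3_eq_cube mult_ac)
  obtain X where X: "X \<subseteq> A" "card X * card B \<le> card (sumset A B)"
    "\<And>a. a \<in> A \<Longrightarrow> \<exists>x\<in>X. \<exists>b\<in>B. \<exists>b'\<in>B. a = x + b - b'"
    using ruzsa_covering[OF A(1) finB] by metis
  have "real (card X * card B) \<le> card (sumset A B)" using X(2) by (simp only: of_nat_le_iff)
  moreover have "real (card B) = 8 * K^4"
    by (simp add: B_def bs m_def K_def power_add power_mult[symmetric] mult.commute)
  ultimately have "card X * (8 * K^4) \<le> 4 * K^3 * card A"
    using AB by (simp only: of_nat_mult)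
  then have "4 * K^3 * (card X * (2 * K)) \<le> 4 * K^3 * card A"
    by (simp add: power3_eq_cube power4_eq_xxxx mult_ac)
  then have "card X * (2 * K) \<le> card A" using K by (simp add: mult_ac)
  then have "card X < card A / K" using K posA by (simp add: field_simps)
  then show thesis using that[of bs X] X bs(1) by (simp add: m_def K_def B_def)
qed

section \<open>The circle group\<close>

text \<open>All groups \<open>\<int>/p\<int>\<close> embed into this single type, which makes type class algebra available for them.\<close>

quotient_type circle = real / "\<lambda>x y. x - y \<in> \<int>"
proof (rule equivpI)
  show "reflp (\<lambda>x y::real. x - y \<in> \<int>)" by (simp add: reflp_def)
  show "symp (\<lambda>x y::real. x - y \<in> \<int>)"
  proof (rule sympI)
    fix x y :: real assume "x - y \<in> \<int>"
    then have "- (x - y) \<in> \<int>" by (rule Ints_minus)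
    then show "y - x \<in> \<int>" by simp
  qed
  show "transp (\<lambda>x y::real. x - y \<in> \<int>)"
  proof (rule transpI)
    fix x y z :: real assume "x - y \<in> \<int>" "y - z \<in> \<int>"
    then have "(x - y) + (y - z) \<in> \<int>" by (rule Ints_add)
    then show "x - z \<in> \<int>" by simp
  qed
qed

lift_definition to_circle :: "real \<Rightarrow> circle" is "\<lambda>x. x" .

text \<open>Only integer factors preserve the integers and hence act on the quotient.\<close>

lift_definition circle_scale :: "int \<Rightarrow> circle \<Rightarrow> circle" is "\<lambda>n x. of_int n * x"
  by (simp add: Ints_mult flip: right_diff_distrib)

instantiation circle :: ab_group_add
begin

lift_definition zero_circle :: circle is 0 .

lift_definition plus_circle :: "circle \<Rightarrow> circle \<Rightarrow> circle" is "(+)"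
  unfolding add_diff_add by (rule Ints_add)

lift_definition uminus_circle :: "circle \<Rightarrow> circle" is uminus
  unfolding minus_diff_minus by (rule Ints_minus)

definition minus_circle :: "circle \<Rightarrow> circle \<Rightarrow> circle" where
  "minus_circle x y = x + - y"

instance
proof
  fix a b c :: circle
  show "a + b + c = a + (b + c)" by transfer (simp add: algebra_simps)
  show "a + b = b + a" by transfer (simp add: algebra_simps)
  show "0 + a = a" by transfer simp
  show "- a + a = 0" by transfer simp
  show "a - b = a + - b" by (simp add: minus_circle_def)
qed

end

lemma to_circle_add: "to_circle (x + y) = to_circle x + to_circle y"
  by transfer simp

lemma to_circle_minus: "to_circle (- x) = - to_circle x"
  by transfer simp

lemma to_circle_diff: "to_circle (x - y) = to_circle x - to_circle y"
  using to_circle_add[of x "- y"] by (simp add: to_circle_minus)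

lemma to_circle_0: "to_circle 0 = 0"
  by transfer simp

lemma to_circle_eq_iff: "to_circle x = to_circle y \<longleftrightarrow> x - y \<in> \<int>"
  by transfer simp

lemma to_circle_surj: "\<exists>x. c = to_circle x"
proof -
  obtain x where "c = abs_circle x" by (metis Quotient3_circle Quotient3_abs_rep)
  then show ?thesis by (auto simp: to_circle_def)
qed

lemma circle_scale_to_circle: "circle_scale n (to_circle x) = to_circle (of_int n * x)"
  by transfer simp

lemma circle_scale_add: "circle_scale n (a + b) = circle_scale n a + circle_scale n b"
  by transfer (simp add: algebra_simps)

lemma circle_scale_diff: "circle_scale n (a - b) = circle_scale n a - circle_scale n b"
  using circle_scale_add[of n "a - b" b] by simp

lemma inj_on_to_circle: "inj_on to_circle {0..<1}"
proof (rule inj_onI)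
  fix x y :: real assume xy: "x \<in> {0..<1}" "y \<in> {0..<1}" "to_circle x = to_circle y"
  then obtain n :: int where n: "x - y = of_int n" by (auto simp: to_circle_eq_iff elim: Ints_cases)
  then have "\<bar>real_of_int n\<bar> < 1" using xy by auto
  then have "n = 0" by linarith
  then show "x = y" using n by simp
qed

text \<open>Walking forward inside \<open>S\<close> for \<open>card S\<close> steps visits
  \<open>card S + 1\<close> points. If the walk stayed short of a full turn, these would be distinct
  points of \<open>S\<close>.\<close>

lemma circle_gap_bound:
  fixes \<epsilon> :: real
  assumes S: "finite S" "S \<noteq> {}" and eps: "\<epsilon> \<ge> 0"
    and step: "\<And>m. m \<in> S \<Longrightarrow> \<exists>d. 0 < d \<and> d \<le> \<epsilon> \<and> m + to_circle d \<in> S"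
  shows "1 \<le> card S * \<epsilon>"
proof (rule ccontr)
  assume small: "\<not> 1 \<le> card S * \<epsilon>"
  obtain m where m: "m \<in> S" using S by auto
  \<comment> \<open>\<open>R\<close> collects real lifts of the points visited; stepping from
    \<open>Max R\<close> guarantees that the next lift is new.\<close>
  have "\<exists>R. finite R \<and> card R = Suc n \<and> R \<subseteq> {r. 0 \<le> r \<and> r \<le> n * \<epsilon> \<and> m + to_circle r \<in> S}" for n :: nat
  proof (induction n)
    case 0
    then show ?case using m by (intro exI[of _ "{0}"]) (simp add: to_circle_0)
  next
    case (Suc n)
    then obtain R where R: "finite R" "card R = Suc n"
      "R \<subseteq> {r. 0 \<le> r \<and> r \<le> n * \<epsilon> \<and> m + to_circle r \<in> S}" by blast
    then have "R \<noteq> {}" by auto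
    define r where "r = Max R"
    have r: "r \<in> R" using R \<open>R \<noteq> {}\<close> by (simp add: r_def)
    then have "m + to_circle r \<in> S" using R by auto
    from step[OF this] obtain d where d: "0 < d" "d \<le> \<epsilon>" "m + to_circle r + to_circle d \<in> S"
      by blast
    have rd: "m + to_circle (r + d) \<in> S" using d(3) by (simp only: to_circle_add add.assoc)
    have "r + d \<notin> R"
    proof
      assume "r + d \<in> R"
      then have "r + d \<le> r" unfolding r_def using R(1) by (rule Max_ge[rotated])
      then show False using d by simp
    qed
    then have "card (insert (r + d) R) = Suc (Suc n)" using R by simp
    moreover have "insert (r + d) R \<subseteq> {r. 0 \<le> r \<and> r \<le> Suc n * \<epsilon> \<and> m + to_circle r \<in> S}"
    proof -
      have e: "Suc n * \<epsilon> = n * \<epsilon> + \<epsilon>" by (simp add: algebra_simps)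
      have "0 \<le> r" "r \<le> n * \<epsilon>" using r R by auto
      then have "0 \<le> r + d" "r + d \<le> n * \<epsilon> + \<epsilon>" using d by auto
      moreover have "x \<le> n * \<epsilon> + \<epsilon>" if "x \<in> R" for x
        using that R(3) eps by force
      ultimately show ?thesis unfolding e using R(3) rd by blast
    qed
    ultimately show ?case using R(1) by (intro exI[of _ "insert (r + d) R"]) blast
  qed
  then obtain R where R: "finite R" "card R = Suc (card S)"
    "R \<subseteq> {r. 0 \<le> r \<and> r \<le> card S * \<epsilon> \<and> m + to_circle r \<in> S}" by blast
  have "R \<subseteq> {0..<1}" using R small by auto
  then have "inj_on (\<lambda>r. m + to_circle r) R"
    using inj_on_subset[OF inj_on_to_circle] by (auto simp: inj_on_def)
  moreover have "(\<lambda>r. m + to_circle r) ` R \<subseteq> S" using R by auto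
  ultimately have "card R \<le> card S" using S by (intro card_inj_on_le) auto
  then show False using R by simp
qed

text \<open>If every sum had more than \<open>|X|\<close> representations, two of the first summands would lie in a
  common short arc; exchanging one for the other moves the sum forward by less than the arc length,
  so that \<open>A + A\<close> would go all the way round the circle.\<close>

lemma exists_unpopular_sum:
  fixes \<epsilon> :: real
  assumes A: "finite A" "A \<noteq> {}" and X: "finite X" and eps: "\<epsilon> \<ge> 0"
    and cover: "\<And>a. a \<in> A \<Longrightarrow> \<exists>x\<in>X. \<exists>r. \<bar>r\<bar> \<le> \<epsilon> \<and> a = x + to_circle r"
    and small: "card (sumset A A) * (2 * \<epsilon>) < 1"
  shows "\<exists>z\<in>sumset A A. card {a \<in> A. z - a \<in> A} \<le> card X"
proof (rule ccontr)
  assume contr: "\<not> ?thesis"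
  have "1 \<le> card (sumset A A) * (2 * \<epsilon>)"
  proof (rule circle_gap_bound)
    fix m assume m: "m \<in> sumset A A"
    let ?R = "{a \<in> A. m - a \<in> A}"
    have "\<forall>a\<in>?R. \<exists>x r. x \<in> X \<and> \<bar>r\<bar> \<le> \<epsilon> \<and> a = x + to_circle r" using cover by blast
    then obtain f g where fg: "\<And>a. a \<in> ?R \<Longrightarrow> f a \<in> X \<and> \<bar>g a\<bar> \<le> \<epsilon> \<and> a = f a + to_circle (g a)"
      by metis
    have "card (f ` ?R) \<le> card X" using fg X by (intro card_mono) auto
    also have "\<dots> < card ?R" using contr m by auto
    finally have "\<not> inj_on f ?R" by (rule pigeonhole)
    then obtain a b where ab: "a \<in> ?R" "b \<in> ?R" "a \<noteq> b" "f a = f b" by (auto simp: inj_on_def)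
    have "g a \<noteq> g b" using fg[OF ab(1)] fg[OF ab(2)] ab(3,4) by metis
    \<comment> \<open>In \<open>m = a + (m - a)\<close> the summand \<open>a\<close> is replaced by
      the point \<open>b\<close> lying further along the same arc.\<close>
    have main: "\<exists>d. 0 < d \<and> d \<le> 2 * \<epsilon> \<and> m + to_circle d \<in> sumset A A"
      if "a \<in> ?R" "b \<in> ?R" "f a = f b" "g a < g b" for a b
    proof (intro exI[of _ "g b - g a"] conjI)
      show "0 < g b - g a" using that by simp
      show "g b - g a \<le> 2 * \<epsilon>" using fg[OF that(1)] fg[OF that(2)] by auto
      have "to_circle (g b - g a) = b - a"
        using fg[OF that(1)] fg[OF that(2)] that(3) by (metis add_diff_cancel_left to_circle_diff)
      then have eq: "m + to_circle (g b - g a) = b + (m - a)" by (simp add: algebra_simps)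
      show "m + to_circle (g b - g a) \<in> sumset A A"
        unfolding eq using that by (intro sumsetI) auto
    qed
    show "\<exists>d. 0 < d \<and> d \<le> 2 * \<epsilon> \<and> m + to_circle d \<in> sumset A A"
      using main[of a b] main[of b a] ab \<open>g a \<noteq> g b\<close> by (metis linorder_neqE_linordered_idom)
  qed (use A eps in \<open>auto simp: sumset_def\<close>)
  then show False using small by simp
qed

section \<open>Residues on the circle\<close>

lemma residue_ring_add: "x \<oplus>\<^bsub>residue_ring n\<^esub> y = (x + y) mod n"
  by (simp add: residue_ring_def)

lemma carrier_residue_ring: "carrier (residue_ring n) = {0..<n}"
  by (auto simp: residue_ring_def)

text \<open>The embedding of residues into the circle followed by dilation by \<open>t\<close>. With
  \<open>t\<close> as a parameter, one transfer lemma serves both the original copy of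
  \<open>A\<close> and its dilate.\<close>

definition circle_mult :: "int \<Rightarrow> int \<Rightarrow> int \<Rightarrow> circle" where
  "circle_mult p t a = to_circle (of_int (t * a) / of_int p)"

lemma circle_mult_eq_iff:
  assumes "p > 0"
  shows "circle_mult p t a = circle_mult p t b \<longleftrightarrow> p dvd t * (a - b)"
proof -
  have "circle_mult p t a = circle_mult p t b \<longleftrightarrow> (of_int (t * (a - b)) / of_int p :: real) \<in> \<int>"
    by (simp add: circle_mult_def to_circle_eq_iff right_diff_distrib diff_divide_distrib)
  also have "\<dots> \<longleftrightarrow> p dvd t * (a - b)"
  proof
    assume "(of_int (t * (a - b)) / of_int p :: real) \<in> \<int>"
    then obtain n where "of_int (t * (a - b)) / of_int p = (of_int n :: real)" by (rule Ints_cases)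
    then have "(of_int (t * (a - b)) :: real) = of_int (p * n)" using assms by (simp add: field_simps)
    then have "t * (a - b) = p * n" by (simp only: of_int_eq_iff)
    then show "p dvd t * (a - b)" by simp
  next
    assume "p dvd t * (a - b)"
    then obtain n where "t * (a - b) = p * n" by (auto elim: dvdE)
    then show "(of_int (t * (a - b)) / of_int p :: real) \<in> \<int>" using assms by simp
  qed
  finally show ?thesis .
qed

lemma circle_mult_add: "circle_mult p t (a + b) = circle_mult p t a + circle_mult p t b"
  by (simp add: circle_mult_def distrib_left add_divide_distrib to_circle_add)

lemma circle_mult_mod:
  assumes "p > 0"
  shows "circle_mult p t (a mod p) = circle_mult p t a"
proof -
  have "p dvd a mod p - a" by (metis dvd_diff_commute dvd_minus_mod)
  then show ?thesis using assms by (simp add: circle_mult_eq_iff)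
qed

lemma inj_on_circle_mult:
  assumes "p > 0" "coprime t p"
  shows "inj_on (circle_mult p t) {0..<p}"
proof (rule inj_onI)
  fix a b assume ab: "a \<in> {0..<p}" "b \<in> {0..<p}" "circle_mult p t a = circle_mult p t b"
  then have "p dvd a - b"
    using assms by (simp add: circle_mult_eq_iff coprime_dvd_mult_right_iff coprime_commute)
  then have "a mod p = b mod p" by (simp add: mod_eq_dvd_iff)
  then show "a = b" using ab by simp
qed

lemma circle_scale_circle_mult: "circle_scale t (circle_mult p 1 a) = circle_mult p t a"
  by (simp add: circle_mult_def circle_scale_to_circle)

lemma sumset_circle_mult:
  assumes "p > 0" "z \<in> sumset (circle_mult p t ` A) (circle_mult p t ` A)"
  obtains x where "x \<in> {0..<p}" "z = circle_mult p t x"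
proof -
  from assms(2) obtain a b where "z = circle_mult p t a + circle_mult p t b"
    by (auto elim!: sumsetE)
  then have "z = circle_mult p t ((a + b) mod p)"
    using assms(1) by (simp add: circle_mult_mod circle_mult_add)
  then show thesis using that[of "(a + b) mod p"] assms(1) by simp
qed

text \<open>For \<open>t\<close> coprime to \<open>p\<close> the map respects addition modulo
  \<open>p\<close> and is injective on residues, so it preserves representation counts; a
  representing pair is determined by its first summand.\<close>

lemma self_convolution_circle_mult:
  fixes p t x :: int
  assumes p: "p > 0" "coprime t p" and A: "A \<subseteq> {0..<p}" and x: "x \<in> {0..<p}"
  shows "self_convolution (residue_ring p) A x =
    card {c \<in> circle_mult p t ` A. circle_mult p t x - c \<in> circle_mult p t ` A}"
proof -
  let ?f = "circle_mult p t"
  have inj: "a = b" if "?f a = ?f b" "a \<in> {0..<p}" "b \<in> {0..<p}" for a b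
    using inj_on_circle_mult[OF p] that by (auto dest: inj_onD)
  have iff: "(a + b) mod p = x \<longleftrightarrow> ?f x - ?f a = ?f b" for a b
  proof -
    have "(a + b) mod p = x \<longleftrightarrow> ?f ((a + b) mod p) = ?f x"
      using inj[of "(a + b) mod p" x] x p by auto
    also have "\<dots> \<longleftrightarrow> ?f a + ?f b = ?f x" using p by (simp add: circle_mult_mod circle_mult_add)
    finally show ?thesis by (auto simp: algebra_simps)
  qed
  have "bij_betw (\<lambda>(a, b). ?f a) {(a, b). a \<in> A \<and> b \<in> A \<and> a \<oplus>\<^bsub>residue_ring p\<^esub> b = x}
      {c \<in> ?f ` A. ?f x - c \<in> ?f ` A}"
    unfolding residue_ring_add iff
  proof (rule bij_betwI')
    fix u v
    assume "u \<in> {(a, b). a \<in> A \<and> b \<in> A \<and> ?f x - ?f a = ?f b}"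
      and "v \<in> {(a, b). a \<in> A \<and> b \<in> A \<and> ?f x - ?f a = ?f b}"
    then obtain a b a' b' where "u = (a, b)" "v = (a', b')" "a \<in> A" "b \<in> A" "a' \<in> A" "b' \<in> A"
      "?f x - ?f a = ?f b" "?f x - ?f a' = ?f b'" by auto
    moreover from this have "a \<in> {0..<p}" "a' \<in> {0..<p}" "b \<in> {0..<p}" "b' \<in> {0..<p}"
      using A by blast+
    ultimately show "(case u of (a, b) \<Rightarrow> ?f a) = (case v of (a, b) \<Rightarrow> ?f a) \<longleftrightarrow> u = v"
      using inj[of a a'] inj[of b b'] by auto
  qed auto
  then show ?thesis unfolding self_convolution_def by (rule bij_betw_same_card)
qed

section \<open>Dilating a cube into a short arc\<close>

lemma subset_sums_small_scale:
  fixes \<delta> :: real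
  assumes "\<And>b. b \<in> set bs \<Longrightarrow> \<exists>r. \<bar>r\<bar> \<le> \<delta> \<and> circle_scale t b = to_circle r"
    and "\<delta> \<ge> 0" "y \<in> subset_sums bs"
  shows "\<exists>r. \<bar>r\<bar> \<le> length bs * \<delta> \<and> circle_scale t y = to_circle r"
  using assms(1,3)
proof (induction bs arbitrary: y)
  case Nil
  then show ?case
    using circle_scale_add[of t 0 0] by (intro exI[of _ 0]) (simp add: to_circle_0)
next
  case (Cons b bs)
  have len: "length (b # bs) * \<delta> = length bs * \<delta> + \<delta>" by (simp add: algebra_simps)
  have IH: "\<exists>r. \<bar>r\<bar> \<le> length bs * \<delta> \<and> circle_scale t z = to_circle r" if "z \<in> subset_sums bs" for z
    using Cons.IH[OF Cons.prems(1) that] by simp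
  from Cons.prems(2) consider "y \<in> subset_sums bs" | z where "z \<in> subset_sums bs" "y = b + z" by auto
  then show ?case
  proof cases
    case 1
    then obtain r where "\<bar>r\<bar> \<le> length bs * \<delta>" "circle_scale t y = to_circle r" using IH by blast
    then show ?thesis using assms(2) unfolding len by (intro exI[of _ r]) auto
  next
    case 2
    then obtain r where r: "\<bar>r\<bar> \<le> length bs * \<delta>" "circle_scale t z = to_circle r" using IH by blast
    obtain s where s: "\<bar>s\<bar> \<le> \<delta>" "circle_scale t b = to_circle s" using Cons.prems(1)[of b] by auto
    have "circle_scale t y = to_circle (s + r)" by (simp add: 2 circle_scale_add to_circle_add r s)
    then show ?thesis using r s unfolding len by (intro exI[of _ "s + r"]) auto
  qed
qed

text \<open>Simultaneous Dirichlet approximation applied to real lifts of the generators;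
  subtracting the nearby integers \<open>n i\<close> does not move points of the circle. The bound
  on \<open>t\<close> will be compared with \<open>p\<close>.\<close>

lemma dirichlet_circle:
  fixes N :: nat
  assumes "N > 0"
  obtains t where "0 < t" "t \<le> int (N ^ length bs)"
    "\<And>b. b \<in> set bs \<Longrightarrow> \<exists>r. \<bar>r\<bar> \<le> 1 / N \<and> circle_scale t b = to_circle r"
proof -
  obtain lift where lift: "\<And>c. c = to_circle (lift c)" using to_circle_surj by metis
  obtain t n where t: "0 < t" "t \<le> int (N ^ length bs)"
    and n: "\<And>i. i < length bs \<Longrightarrow> \<bar>of_int t * lift (bs ! i) - of_int (n i)\<bar> < 1 / N"
    using Dirichlet_approx_simult[OF assms, where n = "length bs" and \<theta> = "\<lambda>i. lift (bs ! i)"] by blast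
  show thesis
  proof (rule that[OF t])
    fix b assume "b \<in> set bs"
    then obtain i where i: "i < length bs" "b = bs ! i" by (metis in_set_conv_nth)
    have "circle_scale t b = to_circle (of_int t * lift b)"
      by (metis lift circle_scale_to_circle)
    also have "\<dots> = to_circle (of_int t * lift b - of_int (n i))"
      by (simp add: to_circle_eq_iff)
    finally show "\<exists>r. \<bar>r\<bar> \<le> 1 / N \<and> circle_scale t b = to_circle r"
      using n[OF i(1)] i(2) by (intro exI conjI) auto
  qed
qed

text \<open>Serves to absorb \<open>4 * m\<close> into \<open>|A|^2\<close> when the length of the
  walk round the circle is estimated.\<close>

lemma four_mult_lt_card_square:
  fixes a q :: nat
  assumes "q \<ge> 1" "2 ^ (60000 * q ^ 4) < real a"
  shows "4 * (4 * q + 3) < a"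
proof -
  have "4 * (4 * q + 3) \<le> 60000 * q" using assms(1) by simp
  also have "\<dots> \<le> 60000 * q ^ 4" using assms(1) by (intro mult_left_mono self_le_power) auto
  also have "\<dots> < 2 ^ (60000 * q ^ 4)" by (rule less_exp)
  finally have "real (4 * (4 * q + 3)) < 2 ^ (60000 * q ^ 4)" by (metis of_nat_less_iff of_nat_numeral of_nat_power)
  then have "real (4 * (4 * q + 3)) < real a" using assms(2) by (rule less_trans)
  then show ?thesis by (simp only: of_nat_less_iff)
qed

proposition exists_unpopular_residue_sum:
  fixes p :: nat and A :: "int set" and q :: nat
  assumes p: "prime p" and A: "A \<subseteq> {0..<int p}" "A \<noteq> {}" and q: "q \<ge> 1"
    and large: "2 ^ (60000 * q ^ 4) < real (card A)"
    and p_large: "(card A ^ 4) ^ (4 * q + 3) < p"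
  shows "\<exists>x\<in>{0..<int p}. 0 < self_convolution (residue_ring (int p)) A x \<and>
    self_convolution (residue_ring (int p)) A x \<le> card A / 2 ^ q"
proof (rule ccontr)
  assume contr: "\<not> ?thesis"
  let ?r = "self_convolution (residue_ring (int p)) A"
  have p0: "int p > 0" using p by (simp add: prime_gt_0_nat)
  have finA: "finite A" using A(1) by (rule finite_subset) simp
  have popular: "card A / 2 ^ q < ?r x" if "x \<in> {0..<int p}" "?r x > 0" for x
    using contr that by (meson not_le)
  have conv: "?r x = card {c \<in> circle_mult p t ` A. circle_mult p t x - c \<in> circle_mult p t ` A}"
    if "coprime t (int p)" "x \<in> {0..<int p}" for t x
    using p0 that A(1) by (intro self_convolution_circle_mult) auto
  have cardA: "card (circle_mult p t ` A) = card A" if "coprime t (int p)" for t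
    using inj_on_subset[OF inj_on_circle_mult[OF p0 that] A(1)] by (rule card_image)
  define A1 where "A1 = circle_mult p 1 ` A"
  \<comment> \<open>Popularity is transferred to every coprime dilate: \<open>t = 1\<close> yields
    the cover, the Dirichlet multiplier the contradiction.\<close>
  have pop: "card A / 2 ^ q < card {c \<in> circle_mult p t ` A. z - c \<in> circle_mult p t ` A}"
    if t: "coprime t (int p)" and z: "z \<in> sumset (circle_mult p t ` A) (circle_mult p t ` A)" for t z
  proof -
    obtain x where x: "x \<in> {0..<int p}" "z = circle_mult p t x"
      using sumset_circle_mult[OF p0 z] by blast
    have "{c \<in> circle_mult p t ` A. z - c \<in> circle_mult p t ` A} \<noteq> {}"
      using z by (force elim!: sumsetE)
    then have "?r x > 0" using conv[OF t x(1)] finA x(2) by (simp add: card_gt_0_iff)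
    then show ?thesis using popular[OF x(1)] conv[OF t x(1)] x(2) by simp
  qed
  have A1: "finite A1" "A1 \<noteq> {}" "card A1 = card A"
    using finA A(2) cardA[of 1] by (auto simp: A1_def)
  have large1: "2 ^ (60000 * q ^ 4) < real (card A1)" using large A1(3) by simp
  have pop1: "card A1 / 2 ^ q \<le> card {a \<in> A1. z - a \<in> A1}" if "z \<in> sumset A1 A1" for z
    using pop[of 1 z] that A1(3) by (simp add: A1_def less_imp_le)
  obtain bs X where bs: "length bs = 4 * q + 3" and X: "X \<subseteq> A1" "card X < card A1 / 2 ^ q"
    and cover: "\<And>a. a \<in> A1 \<Longrightarrow> \<exists>x\<in>X. \<exists>y\<in>subset_sums bs. \<exists>y'\<in>subset_sums bs. a = x + y - y'"
    using popular_sums_cover[OF A1(1,2) q large1 pop1] by blast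
  \<comment> \<open>There are at most \<open>|A|^2\<close> sums and each step of the walk has length
    at most \<open>4 * m / N\<close>; the fourth power keeps the total below one turn.\<close>
  define N where "N = card A ^ 4"
  define m where "m = 4 * q + 3"
  have cpos: "card A > 0" using finA A(2) by (simp add: card_gt_0_iff)
  then have N: "N > 0" by (simp add: N_def)
  obtain t where t: "0 < t" "t \<le> int (N ^ length bs)"
    "\<And>b. b \<in> set bs \<Longrightarrow> \<exists>r. \<bar>r\<bar> \<le> 1 / N \<and> circle_scale t b = to_circle r"
    using dirichlet_circle[OF N, of bs] by blast
  \<comment> \<open>The size of \<open>p\<close> relative to \<open>A\<close> enters here: a
    positive multiplier below the prime \<open>p\<close> is coprime to it.\<close>
  have "t < int p"
    using t(2) p_large unfolding bs N_def by (meson le_less_trans of_nat_less_iff)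
  then have "\<not> int p dvd t" using t(1) by (auto dest: zdvd_imp_le)
  moreover have "prime (int p)" using p by simp
  ultimately have cop: "coprime t (int p)" using prime_imp_coprime coprime_commute by blast
  define A2 where "A2 = circle_mult p t ` A"
  have A2: "A2 = circle_scale t ` A1" "finite A2" "A2 \<noteq> {}" "card A2 = card A"
    using finA A(2) cardA[OF cop] by (auto simp: A1_def A2_def image_image circle_scale_circle_mult)
  define X2 where "X2 = circle_scale t ` X"
  have finX: "finite X" using X(1) A1(1) by (rule finite_subset)
  \<comment> \<open>After dilation, \<open>y\<close> and \<open>y'\<close> contribute at most
    \<open>m / N\<close> each.\<close>
  define \<epsilon> where "\<epsilon> = 2 * (m / real N)"
  have "\<exists>z\<in>sumset A2 A2. card {a \<in> A2. z - a \<in> A2} \<le> card X2"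
  proof (rule exists_unpopular_sum[where \<epsilon> = \<epsilon>])
    fix a assume "a \<in> A2"
    then obtain a1 where a1: "a1 \<in> A1" "a = circle_scale t a1" unfolding A2(1) by blast
    then obtain x y y' where xy: "x \<in> X" "y \<in> subset_sums bs" "y' \<in> subset_sums bs" "a1 = x + y - y'"
      using cover by blast
    have "\<exists>r. \<bar>r\<bar> \<le> length bs * (1 / N) \<and> circle_scale t w = to_circle r" if "w \<in> subset_sums bs" for w
      using subset_sums_small_scale[OF t(3) _ that] by simp
    then obtain r r' where r: "\<bar>r\<bar> \<le> m / real N" "circle_scale t y = to_circle r"
      "\<bar>r'\<bar> \<le> m / real N" "circle_scale t y' = to_circle r'"
      using xy by (metis bs m_def mult.right_neutral times_divide_eq_right)
    have "a = circle_scale t x + to_circle (r - r')"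
      by (simp add: a1 xy circle_scale_add circle_scale_diff r to_circle_diff)
    moreover have "\<bar>r - r'\<bar> \<le> \<epsilon>" using r by (simp add: \<epsilon>_def)
    ultimately show "\<exists>x\<in>X2. \<exists>r. \<bar>r\<bar> \<le> \<epsilon> \<and> a = x + to_circle r"
      using xy(1) unfolding X2_def by blast
  next
    have "card (sumset A2 A2) \<le> card (A2 \<times> A2)"
      unfolding sumset_def using A2 by (intro card_image_le) auto
    then have "card (sumset A2 A2) * (4 * m) \<le> card A ^ 2 * (4 * m)"
      by (simp add: card_cartesian_product A2(4) power2_eq_square)
    also have "\<dots> < card A ^ 2 * card A ^ 2"
    proof -
      have "4 * m < card A" unfolding m_def by (rule four_mult_lt_card_square[OF q large])
      also have "\<dots> \<le> card A ^ 2" using cpos by (simp add: power2_eq_square)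
      finally show ?thesis using cpos by (intro mult_strict_left_mono) auto
    qed
    also have "\<dots> = N" by (simp add: N_def flip: power_add)
    finally have "real (card (sumset A2 A2) * (4 * m)) < N" by (simp only: of_nat_less_iff)
    then show "card (sumset A2 A2) * (2 * \<epsilon>) < 1"
      using N by (simp add: \<epsilon>_def field_simps)
  qed (use A2 finX in \<open>auto simp: X2_def \<epsilon>_def\<close>)
  then obtain z where z: "z \<in> sumset A2 A2" "card {a \<in> A2. z - a \<in> A2} \<le> card X2" by blast
  have "card X2 \<le> card X" unfolding X2_def using finX by (rule card_image_le)
  then have "real (card {a \<in> A2. z - a \<in> A2}) \<le> card X" using z(2) by linarith
  moreover have "card A / 2 ^ q < card {a \<in> A2. z - a \<in> A2}"
    using pop[OF cop] z(1) by (simp add: A2_def)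
  ultimately show False using X(2) A1(3) by simp
qed


section \<open>Choice of parameters and the final bound\<close>

text \<open>With \<open>L = log 2 a\<close>, the left side has logarithm at most
  \<open>28 * L^2\<close>, since \<open>4 * q + 3\<close> is at most \<open>7 * L\<close>. As
  \<open>ln 2\<close> is at least 2/3, squaring the size hypothesis gives \<open>log 2 p\<close> at
  least \<open>400 / 9 * L^2\<close>.\<close>

lemma power_lt_of_card_le_exp_sqrt_log:
  fixes a p q :: nat
  assumes q: "q \<ge> 1" and large: "60000 * real q ^ 4 \<le> log 2 a" and a: "a > 0" and p: "p > 1"
    and le: "real a \<le> exp (1 / 10 * sqrt (log 2 p))"
  shows "(a ^ 4) ^ (4 * q + 3) < p"
proof -
  define L where "L = log 2 a"
  have "real q \<le> real q ^ 4" using q by (intro self_le_power) auto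
  then have qL: "real q \<le> L" using large unfolding L_def by linarith
  have L: "L \<ge> 1" using qL q by linarith
  have "ln a \<le> 1 / 10 * sqrt (log 2 p)"
    using le a by (metis ln_exp ln_le_cancel_iff exp_gt_zero of_nat_0_less_iff)
  moreover have "ln a = L * ln 2" by (simp add: L_def log_def)
  ultimately have "L * ln 2 \<le> 1 / 10 * sqrt (log 2 p)" by simp
  moreover have "L * (2 / 3) \<le> L * ln 2" using ln2_ge_two_thirds L by (intro mult_left_mono) auto
  ultimately have "20 / 3 * L \<le> sqrt (log 2 p)" by linarith
  then have "(20 / 3 * L)^2 \<le> (sqrt (log 2 p))^2" using L by (intro power_mono) auto
  also have "\<dots> = log 2 p" using p by simp
  finally have p_log: "400 / 9 * L^2 \<le> log 2 p" by (simp add: power_mult_distrib power2_eq_square)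
  have "4 * (4 * real q + 3) * L \<le> 4 * (7 * L) * L"
    using qL q L by (intro mult_right_mono mult_left_mono) auto
  also have "\<dots> < 400 / 9 * L^2" using L by (simp add: power2_eq_square)
  also note p_log
  finally have "4 * (4 * real q + 3) * L < log 2 p" .
  moreover have "log 2 ((real a ^ 4) ^ (4 * q + 3)) = 4 * (4 * real q + 3) * L"
    using a by (simp add: L_def log_nat_power flip: power_mult)
  ultimately have "log 2 ((real a ^ 4) ^ (4 * q + 3)) < log 2 p" by simp
  then have "(real a ^ 4) ^ (4 * q + 3) < real p"
    using a p by (subst (asm) log_less_cancel_iff) auto
  then have "real ((a ^ 4) ^ (4 * q + 3)) < real p" by simp
  then show ?thesis by (simp only: of_nat_less_iff)
qed

theorem theorem25:
  shows "\<exists>c c' C :: real. c > 0 \<and> c' > 0 \<and> C > 0 \<and>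
    (\<forall>(p :: nat) (A :: int set).
      prime p \<longrightarrow> A \<subseteq> carrier (residue_ring (int p)) \<longrightarrow> A \<noteq> {} \<longrightarrow>
      real (card A) \<le> exp (c * sqrt (log 2 (real p))) \<longrightarrow>
      (\<exists>x \<in> carrier (residue_ring (int p)).
        0 < self_convolution (residue_ring (int p)) A x \<and>
        real (self_convolution (residue_ring (int p)) A x)
          \<le> C * exp (- c' * (log 2 (real (card A))) powr (1 / 4)) * real (card A)))"
proof -
  \<comment> \<open>Chosen so that the exponential factor becomes \<open>2 powr (- s)\<close> with
    \<open>s = (L / 60001) powr (1 / 4)\<close>; 60001 instead of 60000 leaves room for the strict
    inequality on \<open>|A|\<close>.\<close>
  define c' where "c' = ln 2 / 60001 powr (1 / 4 :: real)"
  have "\<exists>x \<in> carrier (residue_ring (int p)).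
        0 < self_convolution (residue_ring (int p)) A x \<and>
        real (self_convolution (residue_ring (int p)) A x)
          \<le> 2 * exp (- c' * (log 2 (real (card A))) powr (1 / 4)) * real (card A)"
    if p: "prime p" and A: "A \<subseteq> carrier (residue_ring (int p))" "A \<noteq> {}"
      and le: "real (card A) \<le> exp (1 / 10 * sqrt (log 2 (real p)))" for p :: nat and A :: "int set"
  proof -
    let ?r = "self_convolution (residue_ring (int p)) A"
    have A': "A \<subseteq> {0..<int p}" using A(1) by (simp add: carrier_residue_ring)
    have finA: "finite A" using A' by (rule finite_subset) simp
    have p0: "int p > 0" using p by (simp add: prime_gt_0_nat)
    have pos: "card A > 0" using finA A(2) by (simp add: card_gt_0_iff)
    define L where "L = log 2 (real (card A))"
    define s where "s = (L / 60001) powr (1 / 4)"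
    define q where "q = nat \<lfloor>s\<rfloor>"
    have L: "L \<ge> 0" using pos by (simp add: L_def)
    have s: "s \<ge> 0" by (simp add: s_def)
    have qs: "real q \<le> s" "s < real q + 1" using s by (auto simp: q_def)
    have "exp (- c' * L powr (1 / 4)) = exp (- s * ln 2)"
      using L by (simp add: c'_def s_def powr_divide)
    also have "\<dots> = 2 powr (- s)" by (simp add: powr_def)
    finally have e: "exp (- c' * L powr (1 / 4)) = 2 powr (- s)" .
    \<comment> \<open>Rounding \<open>s\<close> down to \<open>q\<close> costs at most a factor 2,
      which becomes the constant \<open>C\<close>.\<close>
    have "1 / 2 ^ q = 2 * 2 powr (- (real q + 1))"
      using powr_minus[of 2 "real q + 1"] powr_realpow[of 2 "q + 1"] by (simp add: field_simps)
    also have "\<dots> \<le> 2 * 2 powr (- s)" using qs by simp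
    finally have bound: "1 / 2 ^ q \<le> 2 * exp (- c' * L powr (1 / 4))" by (simp only: e)
    have "\<exists>x\<in>{0..<int p}. 0 < ?r x \<and> ?r x \<le> card A / 2 ^ q"
    \<comment> \<open>For \<open>q = 0\<close> the target is just \<open>card A\<close>, and any sum
      such as \<open>a + a\<close> meets it, because the first summand determines the
      second.\<close>
    proof (cases "q = 0")
      case True
      obtain a where a: "a \<in> A" using A(2) by auto
      let ?S = "{(b, b'). b \<in> A \<and> b' \<in> A \<and> (b + b') mod int p = (a + a) mod int p}"
      have "finite ?S" using finA by (intro finite_subset[of ?S "A \<times> A"]) auto
      moreover have "(a, a) \<in> ?S" using a by simp
      ultimately have "0 < card ?S" unfolding card_gt_0_iff by blast
      moreover have "card ?S \<le> card A"
      proof (rule card_inj_on_le[where f = fst])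
        show "inj_on fst ?S"
        proof (rule inj_onI)
          fix u v assume "u \<in> ?S" "v \<in> ?S" "fst u = fst v"
          then obtain b c d where h: "u = (b, c)" "v = (b, d)" "c \<in> A" "d \<in> A"
            "(b + c) mod int p = (a + a) mod int p" "(b + d) mod int p = (a + a) mod int p" by auto
          then have "(b + c) mod int p = (b + d) mod int p" by simp
          then have "int p dvd c - d" by (simp add: mod_eq_dvd_iff)
          then have "c mod int p = d mod int p" by (simp only: mod_eq_dvd_iff)
          moreover have "c \<in> {0..<int p}" "d \<in> {0..<int p}" using h A' by auto
          ultimately show "u = v" using h by simp
        qed
      qed (use finA in auto)
      moreover have "?r ((a + a) mod int p) = card ?S"
        by (simp add: self_convolution_def residue_ring_add)
      ultimately show ?thesis using True p0 by (intro bexI[of _ "(a + a) mod int p"]) auto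
    next
      case False
      have "L \<noteq> 0" using False by (auto simp: q_def s_def)
      have "real q ^ 4 \<le> s ^ 4" using qs by (intro power_mono) auto
      also have "s ^ 4 = L / 60001"
        unfolding s_def using L \<open>L \<noteq> 0\<close> by (subst powr_power) auto
      finally have qL: "60001 * real q ^ 4 \<le> L" by simp
      have q1: "q \<ge> 1" using False by simp
      then have "real q ^ 4 > 0" by simp
      then have less: "60000 * real q ^ 4 < L" using qL by linarith
      have "2 ^ (60000 * q ^ 4) = (2::real) powr (60000 * real q ^ 4)"
        by (simp flip: powr_realpow)
      also have "\<dots> < 2 powr L" using less by simp
      also have "\<dots> = card A" using pos by (simp add: L_def)
      finally have large: "2 ^ (60000 * q ^ 4) < real (card A)" .
      have "(card A ^ 4) ^ (4 * q + 3) < p"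
        using less p by (intro power_lt_of_card_le_exp_sqrt_log[OF q1 _ pos _ le])
          (use prime_gt_1_nat[OF p] in \<open>auto simp: L_def\<close>)
      then show ?thesis using exists_unpopular_residue_sum[OF p A' A(2) q1 large] by simp
    qed
    then obtain x where x: "x \<in> {0..<int p}" "0 < ?r x" "?r x \<le> card A / 2 ^ q" by blast
    have "1 / 2 ^ q * card A \<le> 2 * exp (- c' * L powr (1 / 4)) * card A"
      using bound by (rule mult_right_mono) simp
    then have "?r x \<le> 2 * exp (- c' * L powr (1 / 4)) * card A" using x(3) by simp
    then show ?thesis using x(1,2) unfolding carrier_residue_ring L_def by blast
  qed
  moreover have "c' > 0" by (simp add: c'_def)
  ultimately show ?thesis by (intro exI[of _ "1 / 10"] exI[of _ c'] exI[of _ 2]) auto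
qed

end
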